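(* Let $\Theta$ be a finite set, $1\le T\le\infty$, and $\mu\in\operatorname{int}\Delta(\Theta)$ a prior. Let $\pi_1$ and $\pi_2$ be two dynamic information structures with horizon $T$, inducing at prior $\mu$ the sequences $(F_t)_{t=1}^T$ and $(G_t)_{t=1}^T$, respectively, of period-$t$ distributions over posteriors. For a sequence $\beta=(\beta_t)_{t=1}^T$ of nonnegative reals with $0<\bar\beta:=\sum_{t=1}^T\beta_t<\infty$ put $F^\beta=\sum_{t=1}^T\frac{\beta_t}{\bar\beta}F_t$ and $G^\beta=\sum_{t=1}^T\frac{\beta_t}{\bar\beta}G_t$. Then $\pi_1$ dominates $\pi_2$ in the class of discounted problems, i.e. $W(\pi_1)\ge W(\pi_2)$ for every discounted problem with state space $\Theta$ and horizon $T$, if and only if $F^\beta\succeq G^\beta$ for every such sequence $\beta$.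
   Context: Periods are $t\in\{1,\dots,T\}$ (all positive integers if $T=\infty$). $\Delta(X)$ denotes the probability measures on $X$. Dynamic information structure: compact signal spaces $S_1,\dots,S_T$ and a stochastic map $\pi:\Theta\to\Delta(S)$, $S=\prod_t S_t$. The agent observes $s_t\in S_t$ in period $t$ before acting, so in period $t$ she knows $s^t=(s_1,\dots,s_t)$. With $\theta\sim\mu$ and $s\mid\theta\sim\pi(\cdot\mid\theta)$, the period-$t$ distribution over posteriors, an element of $\Delta(\Delta(\Theta))$, is the law of the posterior belief about $\theta$ conditional on $s^t$. Discounted problem: a sequence $\beta=(\beta_t)_{t=1}^T$ of nonnegative reals with $0<\sum_t\beta_t<\infty$, a nonempty compact action set $A^*$, available in every period, and a continuous $v:A^*\times\Theta\to\mathbb{R}$; the total utility is $\sum_{t=1}^T\beta_t v(a_t,\theta)$. (Here $\beta$ is part of the problem and varies within the class.) Value of a signal: put $V(x)=\max_{a\in A^*}\sum_\theta x(\theta)v(a,\theta)$ for $x\in\Delta(\Theta)$. The agent's optimal ex ante expected utility under a structure $\pi$ with period-$t$ posterior distributions $F_t$ is $W(\pi)=\sum_{t=1}^T\beta_t\,\mathbb{E}_{x\sim F_t}[V(x)]$. $F\succeq G$, for $F,G\in\Delta(\Delta(\Theta))$, means that $F$ is a mean-preserving spread of $G$: there are random vectors $X\sim F$, $Y\sim G$ on a common probability space with $\mathbb{E}[X\mid Y]=Y$ (equivalently, $\mathbb{E}_F\varphi\ge\mathbb{E}_G\varphi$ for every continuous convex $\varphi:\Delta(\Theta)\to\mathbb{R}$).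 *)

theory Defs
  imports "HOL-Probability.Probability" "HOL-Library.Extended_Nat"
begin

text \<open>
  The state space is a type \<open>'a\<close> of class \<open>finite\<close>; a belief is a vector of type \<open>real ^ 'a\<close>.
  Elements of \<open>\<Delta>(\<Delta>(\<Theta>))\<close> are represented by Borel probability measures on \<open>real ^ 'a\<close> that give
  full mass to \<open>belief_simplex\<close>.
\<close>

definition belief_simplex :: "(real ^ 'a::finite) set" where
  "belief_simplex = {x. (\<forall>\<theta>. 0 \<le> x $ \<theta>) \<and> (\<Sum>\<theta>\<in>UNIV. x $ \<theta>) = 1}"

definition periods :: "enat \<Rightarrow> nat set" where
  "periods T = {t. 1 \<le> t \<and> enat t \<le> T}"

definition borel_of_topology :: "'s topology \<Rightarrow> 's measure" where
  "borel_of_topology X = sigma (topspace X) {U. openin X U}"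

text \<open>
  \<open>mixture I w K\<close> is the measure \<open>\<Sum>i\<in>I. w i \<cdot> K i\<close>, as a Giry bind over the
  measure on the discrete space \<open>I\<close> with point masses \<open>w i\<close>.
\<close>

definition mixture :: "'i set \<Rightarrow> ('i \<Rightarrow> real) \<Rightarrow> ('i \<Rightarrow> 'x measure) \<Rightarrow> 'x measure" where
  "mixture I w K = point_measure I (\<lambda>i. ennreal (w i)) \<bind> K"


subsection \<open>Dynamic information structures\<close>

text \<open>
  All signal spaces are topologies with an arbitrary carrier inside one type \<open>'s\<close>; they may differ
  from period to period. A signal path is an element of the extensional product over the periods.
  Since the state space is finite, any family of probability measures is a stochastic map.
\<close>

definition info_structure ::
  "enat \<Rightarrow> (nat \<Rightarrow> 's topology) \<Rightarrow> ('a::finite \<Rightarrow> (nat \<Rightarrow> 's) measure) \<Rightarrow> bool" where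
  "info_structure T S \<pi> \<longleftrightarrow>
     (\<forall>t\<in>periods T. compact_space (S t)) \<and>
     (\<forall>\<theta>. prob_space (\<pi> \<theta>) \<and>
          sets (\<pi> \<theta>) = sets (borel_of_topology (product_topology S (periods T))))"

text \<open>The joint law of \<open>(\<theta>, s)\<close> when \<open>\<theta> \<sim> \<mu>\<close> and \<open>s | \<theta> \<sim> \<pi>(\<cdot> | \<theta>)\<close>.\<close>

definition joint_law ::
  "enat \<Rightarrow> real ^ 'a::finite \<Rightarrow> (nat \<Rightarrow> 's topology) \<Rightarrow> ('a \<Rightarrow> (nat \<Rightarrow> 's) measure) \<Rightarrow>
   ('a \<times> (nat \<Rightarrow> 's)) measure" where
  "joint_law T \<mu> S \<pi> =
     mixture UNIV (\<lambda>\<theta>. \<mu> $ \<theta>)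
       (\<lambda>\<theta>. distr (\<pi> \<theta>)
              (count_space UNIV \<Otimes>\<^sub>M borel_of_topology (product_topology S (periods T)))
              (\<lambda>s. (\<theta>, s)))"

text \<open>The sigma-algebra generated by the signal history \<open>(s\<^sub>1, \<dots>, s\<^sub>t)\<close>.\<close>

definition history_algebra ::
  "enat \<Rightarrow> real ^ 'a::finite \<Rightarrow> (nat \<Rightarrow> 's topology) \<Rightarrow> ('a \<Rightarrow> (nat \<Rightarrow> 's) measure) \<Rightarrow> nat \<Rightarrow>
   ('a \<times> (nat \<Rightarrow> 's)) measure" where
  "history_algebra T \<mu> S \<pi> t =
     vimage_algebra (space (joint_law T \<mu> S \<pi>)) (\<lambda>\<omega>. restrict (snd \<omega>) {1..t})
       (borel_of_topology (product_topology S {1..t}))"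

definition posterior ::
  "enat \<Rightarrow> real ^ 'a::finite \<Rightarrow> (nat \<Rightarrow> 's topology) \<Rightarrow> ('a \<Rightarrow> (nat \<Rightarrow> 's) measure) \<Rightarrow> nat \<Rightarrow>
   'a \<times> (nat \<Rightarrow> 's) \<Rightarrow> real ^ 'a" where
  "posterior T \<mu> S \<pi> t \<omega> =
     (\<chi> \<theta>. real_cond_exp (joint_law T \<mu> S \<pi>) (history_algebra T \<mu> S \<pi> t)
              (indicator {\<omega>'. fst \<omega>' = \<theta>}) \<omega>)"

text \<open>
  The chosen version of the posterior is unique and lies in the simplex only almost surely;
  its law does not depend on the version.
\<close>

definition posterior_law ::
  "enat \<Rightarrow> real ^ 'a::finite \<Rightarrow> (nat \<Rightarrow> 's topology) \<Rightarrow> ('a \<Rightarrow> (nat \<Rightarrow> 's) measure) \<Rightarrow> nat \<Rightarrow>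
   (real ^ 'a) measure" where
  "posterior_law T \<mu> S \<pi> t = distr (joint_law T \<mu> S \<pi>) borel (posterior T \<mu> S \<pi> t)"


subsection \<open>Discounted problems\<close>

definition discount_sequence :: "enat \<Rightarrow> (nat \<Rightarrow> real) \<Rightarrow> bool" where
  "discount_sequence T \<beta> \<longleftrightarrow>
     (\<forall>t\<in>periods T. 0 \<le> \<beta> t) \<and> \<beta> summable_on periods T \<and> 0 < infsum \<beta> (periods T)"

definition discounted_problem ::
  "enat \<Rightarrow> (nat \<Rightarrow> real) \<Rightarrow> 'b topology \<Rightarrow> ('b \<Rightarrow> 'a::finite \<Rightarrow> real) \<Rightarrow> bool" where
  "discounted_problem T \<beta> A v \<longleftrightarrow>
     discount_sequence T \<beta> \<and> compact_space A \<and> topspace A \<noteq> {} \<and>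
     continuous_map (prod_topology A (discrete_topology UNIV)) euclideanreal (\<lambda>(a, \<theta>). v a \<theta>)"

text \<open>The supremum is a maximum when \<open>A\<close> is nonempty and compact and \<open>v\<close> is continuous.\<close>

definition belief_value :: "'b topology \<Rightarrow> ('b \<Rightarrow> 'a::finite \<Rightarrow> real) \<Rightarrow> real ^ 'a \<Rightarrow> real" where
  "belief_value A v x = (SUP a\<in>topspace A. \<Sum>\<theta>\<in>UNIV. x $ \<theta> * v a \<theta>)"

definition optimal_utility ::
  "enat \<Rightarrow> (nat \<Rightarrow> real) \<Rightarrow> 'b topology \<Rightarrow> ('b \<Rightarrow> 'a::finite \<Rightarrow> real) \<Rightarrow>
   real ^ 'a \<Rightarrow> (nat \<Rightarrow> 's topology) \<Rightarrow> ('a \<Rightarrow> (nat \<Rightarrow> 's) measure) \<Rightarrow> real" where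
  "optimal_utility T \<beta> A v \<mu> S \<pi> =
     (\<Sum>\<^sub>\<infinity>t\<in>periods T. \<beta> t * (\<integral>x. belief_value A v x \<partial>posterior_law T \<mu> S \<pi> t))"

text \<open>
  Dominance over all discounted problems whose action space is any topology with carrier inside
  the type \<open>'b\<close>, passed as an explicit type argument.
\<close>

definition dominates_discounted ::
  "'b itself \<Rightarrow> enat \<Rightarrow> real ^ 'a::finite \<Rightarrow>
   (nat \<Rightarrow> 's topology) \<Rightarrow> ('a \<Rightarrow> (nat \<Rightarrow> 's) measure) \<Rightarrow>
   (nat \<Rightarrow> 'r topology) \<Rightarrow> ('a \<Rightarrow> (nat \<Rightarrow> 'r) measure) \<Rightarrow> bool" where
  "dominates_discounted (_ :: 'b itself) T \<mu> S\<^sub>1 \<pi>\<^sub>1 S\<^sub>2 \<pi>\<^sub>2 \<longleftrightarrow>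
     (\<forall>\<beta> (A :: 'b topology) v. discounted_problem T \<beta> A v \<longrightarrow>
        optimal_utility T \<beta> A v \<mu> S\<^sub>1 \<pi>\<^sub>1 \<ge> optimal_utility T \<beta> A v \<mu> S\<^sub>2 \<pi>\<^sub>2)"

definition discounted_mixture ::
  "enat \<Rightarrow> (nat \<Rightarrow> real) \<Rightarrow> (nat \<Rightarrow> (real ^ 'a::finite) measure) \<Rightarrow> (real ^ 'a) measure" where
  "discounted_mixture T \<beta> F = mixture (periods T) (\<lambda>t. \<beta> t / infsum \<beta> (periods T)) F"


subsection \<open>Mean-preserving spreads\<close>

text \<open>
  The sample space has type \<open>(real ^ 'a) \<times> (real ^ 'a)\<close>; this is no restriction, because any pair
  \<open>(X, Y)\<close> on another probability space can be replaced by the coordinate maps under its joint law.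
  The conditional expectation \<open>E[X | Y] = Y\<close> is taken componentwise.
\<close>

definition mean_preserving_spread ::
  "(real ^ 'a::finite) measure \<Rightarrow> (real ^ 'a) measure \<Rightarrow> bool" (infix \<open>\<succeq>\<close> 50) where
  "F \<succeq> G \<longleftrightarrow>
     (\<exists>(M :: ((real ^ 'a) \<times> (real ^ 'a)) measure) X Y.
        prob_space M \<and> X \<in> borel_measurable M \<and> Y \<in> borel_measurable M \<and>
        distr M borel X = F \<and> distr M borel Y = G \<and>
        (\<forall>\<theta>. AE \<omega> in M.
           real_cond_exp M (vimage_algebra (space M) Y borel) (\<lambda>\<omega>'. X \<omega>' $ \<theta>) \<omega> = Y \<omega> $ \<theta>))"

end

theory Submission
  imports Defs
begin

text \<open>
  Discounted utility is \<open>W(\<pi>) = (\<Sum>\<^sub>t \<beta>\<^sub>t) \<cdot> E[V]\<close> under the discounted mixture, where \<open>V\<close> is the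
  support function of the compact set of payoff vectors; so the theorem is Strassen's theorem for the
  pair of mixtures, tested on maxima of finitely many affine functions only.

  For the hard direction, a martingale coupling is a law on the square of the unit box that
  annihilates countably many continuous functions: those fixing the two marginals and
  \<open>(x - y) f\<^sub>j(y)\<close>. If finitely many of them could not be annihilated approximately, a separating
  combination \<open>a(x) + b(y) + (x - y) \<bullet> h(y)\<close> would be bounded away from \<open>0\<close> from below;
  the affine functions \<open>x \<mapsto> - b(y) - (x - y) \<bullet> h(y)\<close> have a finite maximum that
  contradicts the dominance hypothesis. The approximate couplings are then parametrised by a
  space-filling curve, which makes them laws on \<open>[0, 1]\<close>, so that Helly's theorem supplies the limit.
\<close>

subsection \<open>Measure-determining functions and a space-filling curve\<close>

text \<open>Finite intersections of a countable basis form a countable generating system stable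
  under intersection. The indicator of each of these open sets is a pointwise limit of bounded
  continuous functions, so countably many integrals fix a finite measure. This keeps the coupling
  constraints countable in number.\<close>

lemma countable_measure_determining:
  obtains f :: "nat \<Rightarrow> 'a::{metric_space, second_countable_topology} \<Rightarrow> real"
  where "\<And>j. continuous_on UNIV (f j)"
    and "\<And>j x. 0 \<le> f j x" "\<And>j x. f j x \<le> 1"
    and "\<And>M N. \<lbrakk>finite_measure M; finite_measure N; sets M = sets borel; sets N = sets borel;
            \<And>j. (\<integral>x. f j x \<partial>M) = (\<integral>x. f j x \<partial>N)\<rbrakk> \<Longrightarrow> M = N"
proof -
  obtain B :: "'a set set" where B: "countable B" "topological_basis B"
    using ex_countable_basis by auto
  define E where "E = Inter ` {C. C \<subseteq> B \<and> finite C}"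
  have "countable {C. C \<subseteq> B \<and> finite C}"
    using countable_Collect_finite_subset[OF B(1)] by (simp add: conj_commute)
  then have cE: "countable E" unfolding E_def by auto
  have openE: "open U" if "U \<in> E" for U
    using that topological_basis_open[OF B(2)] unfolding E_def by (auto intro!: open_Inter)
  \<comment> \<open>The whole space enters as the empty intersection. It is the exhausting set of
    finite mass in the uniqueness theorem for measures.\<close>
  have UE: "UNIV \<in> E" unfolding E_def by (rule image_eqI[of _ _ "{}"]) auto
  have stable: "Int_stable E"
  proof (rule Int_stableI)
    fix U V assume "U \<in> E" "V \<in> E"
    then obtain C D where "C \<subseteq> B" "finite C" "D \<subseteq> B" "finite D" "U = \<Inter>C" "V = \<Inter>D"
      unfolding E_def by auto
    then show "U \<inter> V \<in> E"
      unfolding E_def by (intro image_eqI[of _ _ "C \<union> D"]) auto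
  qed
  have BE: "B \<subseteq> E"
    unfolding E_def by (auto intro!: image_eqI[of _ _ "{_}"])
  have sE: "sets borel = sigma_sets UNIV E"
  proof -
    have "sets (borel :: 'a measure) = sigma_sets UNIV B"
      unfolding borel_eq_countable_basis[OF B] by simp
    also have "\<dots> \<subseteq> sigma_sets UNIV E" by (rule sigma_sets_mono') (rule BE)
    finally have "sets (borel :: 'a measure) \<subseteq> sigma_sets UNIV E" .
    moreover have "sigma_sets UNIV E \<subseteq> sets (borel :: 'a measure)"
      using openE by (intro sets.sigma_sets_subset[of _ borel, simplified]) auto
    ultimately show ?thesis by auto
  qed
  \<comment> \<open>The whole space needs its own case: \<open>infdist x {}\<close> is
    \<open>0\<close> by convention, so the general formula would give the zero function
    there.\<close>
  define g where "g = (\<lambda>(U::'a set, m::nat) x. if U = UNIV then 1 else min 1 (real m * infdist x (- U)))"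
  define e where "e = from_nat_into (E \<times> (UNIV :: nat set))"
  have rng: "range e = E \<times> UNIV"
    unfolding e_def using cE UE by (intro range_from_nat_into) auto
  define f where "f j = g (e j)" for j
  have gc: "continuous_on UNIV (g k)" for k
  proof (cases k)
    case (Pair U m)
    have "continuous_on UNIV (\<lambda>x. min 1 (real m * infdist x (- U)))"
      by (intro continuous_intros)
    then show ?thesis unfolding Pair g_def by (cases "U = UNIV") auto
  qed
  have g01: "0 \<le> g k x \<and> g k x \<le> 1" for k x
    by (cases k) (simp add: g_def infdist_nonneg)
  note g = gc conjunct1[OF g01] conjunct2[OF g01]
  have glim: "(\<lambda>m. g (U, m) x) \<longlonglongrightarrow> indicator U x" if "U \<in> E" for U x
  proof (cases "U = UNIV \<or> x \<notin> U")
    case True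
    moreover have "g (U, m) x = 0" if "x \<notin> U" for m
      using that by (auto simp: g_def)
    ultimately show ?thesis by (cases "x \<in> U") (auto simp: g_def)
  next
    case False
    then have pos: "infdist x (- U) > 0"
      using openE[OF that] by (intro infdist_pos_not_in_closed) (auto simp: closed_def)
    obtain n where n: "real n * infdist x (- U) \<ge> 1"
      using reals_Archimedean3[OF pos] by (meson less_imp_le)
    have "g (U, m) x = 1" if "m \<ge> n" for m
    proof -
      have "real n * infdist x (- U) \<le> real m * infdist x (- U)"
        using that infdist_nonneg by (intro mult_right_mono) auto
      then show ?thesis using n by (auto simp: g_def)
    qed
    then have "\<forall>\<^sub>F m in sequentially. g (U, m) x = indicator U x"
      using False by (auto simp: eventually_sequentially)
    then show ?thesis by (rule tendsto_eventually)
  qed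
  have eqI: "M = N" if M: "finite_measure M" "sets M = sets borel"
    and N: "finite_measure N" "sets N = sets borel"
    and eq: "\<And>j. (\<integral>x. f j x \<partial>M) = (\<integral>x. f j x \<partial>N)" for M N
  proof -
    have lim: "(\<lambda>m. \<integral>x. g (U, m) x \<partial>M) \<longlonglongrightarrow> measure M U"
      if "finite_measure M" "sets M = sets borel" "U \<in> E" for U M
    proof -
      interpret finite_measure M by fact
      have [measurable]: "g k \<in> borel_measurable M" for k
        unfolding measurable_cong_sets[OF that(2) refl]
        using g(1) by (rule borel_measurable_continuous_onI)
      have [measurable]: "U \<in> sets M" using that openE by auto
      have "(\<lambda>m. \<integral>x. g (U, m) x \<partial>M) \<longlonglongrightarrow> (\<integral>x. indicator U x \<partial>M)"
      proof (rule integral_dominated_convergence[where w="\<lambda>_. 1"])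
        show "AE x in M. (\<lambda>m. g (U, m) x) \<longlonglongrightarrow> indicator U x" using glim that by auto
      qed (use g in auto)
      then show ?thesis using that(2) sets_eq_imp_space_eq[OF that(2)] by simp
    qed
    show ?thesis
    proof (rule measure_eqI_generator_eq[OF stable, of UNIV _ _ "\<lambda>_. UNIV"])
      fix U assume U: "U \<in> E"
      have "(\<integral>x. g (U, m) x \<partial>M) = (\<integral>x. g (U, m) x \<partial>N)" for m
      proof -
        have "(U, m) \<in> range e" using rng U by auto
        then show ?thesis using eq unfolding f_def by auto
      qed
      then have "measure M U = measure N U"
        using lim[OF M U] lim[OF N U] by (simp add: LIMSEQ_unique)
      then show "emeasure M U = emeasure N U"
        by (simp add: finite_measure.emeasure_eq_measure M N)
    next
      show "emeasure M UNIV \<noteq> \<infinity>" by (simp add: finite_measure.emeasure_finite[OF M(1)])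
    qed (use M N sE UE in auto)
  qed
  show ?thesis
    by (rule that[of f]) (use g eqI in \<open>auto simp: f_def\<close>)
qed

section \<open>Digit expansions and a continuous curve through the Hilbert cube\<close>

lemma suminf_between:
  fixes f g :: "nat \<Rightarrow> real"
  assumes "\<And>n. 0 \<le> f n" "\<And>n. f n \<le> g n" "g sums s"
  shows "summable f" "0 \<le> suminf f" "suminf f \<le> s"
proof -
  show f: "summable f"
    by (rule summable_comparison_test'[OF sums_summable[OF assms(3)], of 0]) (use assms in auto)
  show "0 \<le> suminf f" using assms f by (intro suminf_nonneg)
  have "suminf f \<le> suminf g"
    using assms f sums_summable by (intro suminf_le) auto
  then show "suminf f \<le> s" using sums_unique[OF assms(3)] by simp
qed

text \<open>The digits are differences of consecutive rounded values of \<open>2 ^ k * y\<close>, so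
  the partial sums telescope to \<open>\<lfloor>2 ^ n * y\<rfloor> / 2 ^ n\<close>. At
  \<open>y = 1\<close> these differences all vanish, hence the separate expansion with all digits
  equal to \<open>1\<close>.\<close>

lemma binary_digits:
  fixes y :: real
  assumes "0 \<le> y" "y \<le> 1"
  obtains \<epsilon> :: "nat \<Rightarrow> nat" where "\<And>k. \<epsilon> k \<le> 1" "(\<lambda>k. real (\<epsilon> k) * (1/2) ^ Suc k) sums y"
proof (cases "y = 1")
  case True
  show ?thesis by (rule that[of "\<lambda>_. 1"]) (use True power_half_series in auto)
next
  case False
  define d where "d k = \<lfloor>2 ^ Suc k * y\<rfloor> - 2 * \<lfloor>2 ^ k * y\<rfloor>" for k :: nat
  have d: "0 \<le> d k" "d k \<le> 1" for k unfolding d_def by (simp; linarith)+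
  have "(\<Sum>k<n. real (nat (d k)) * (1/2) ^ Suc k) = of_int \<lfloor>2 ^ n * y\<rfloor> / 2 ^ n" for n
  proof (induction n)
    case 0
    have "\<lfloor>y\<rfloor> = 0" using assms False by linarith
    then show ?case by simp
  next
    case (Suc n)
    have "real (nat (d n)) = of_int \<lfloor>2 ^ Suc n * y\<rfloor> - 2 * of_int \<lfloor>2 ^ n * y\<rfloor>"
      using d(1)[of n] by (simp add: d_def)
    then show ?case using Suc by (simp add: field_simps power_divide)
  qed
  moreover have "(\<lambda>n. of_int \<lfloor>2 ^ n * y\<rfloor> / 2 ^ n) \<longlonglongrightarrow> y"
  proof (rule tendsto_sandwich)
    show "\<forall>\<^sub>F n in sequentially. y - (1/2) ^ n \<le> of_int \<lfloor>2 ^ n * y\<rfloor> / 2 ^ n"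
    proof (rule always_eventually, rule allI)
      fix n :: nat
      have "2 ^ n * y - 1 \<le> of_int \<lfloor>2 ^ n * y\<rfloor>" by linarith
      then have "(2 ^ n * y - 1) / 2 ^ n \<le> of_int \<lfloor>2 ^ n * y\<rfloor> / 2 ^ n"
        by (intro divide_right_mono) auto
      then show "y - (1/2) ^ n \<le> of_int \<lfloor>2 ^ n * y\<rfloor> / 2 ^ n"
        by (simp add: diff_divide_distrib power_one_over)
    qed
    show "\<forall>\<^sub>F n in sequentially. of_int \<lfloor>2 ^ n * y\<rfloor> / 2 ^ n \<le> y"
      by (rule always_eventually) (simp add: field_simps of_int_floor_le)
    have "(\<lambda>n. y - (1/2) ^ n) \<longlonglongrightarrow> y - 0"
      by (intro tendsto_intros LIMSEQ_power_zero) auto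
    then show "(\<lambda>n. y - (1/2) ^ n) \<longlonglongrightarrow> y" by simp
  qed auto
  ultimately have "(\<lambda>k. real (nat (d k)) * (1/2) ^ Suc k) sums y"
    unfolding sums_def by simp
  moreover have "nat (d k) \<le> 1" for k using d[of k] by linarith
  ultimately show ?thesis by (rule that[of "\<lambda>k. nat (d k)", rotated])
qed

text \<open>
  Schoenberg's construction: \<open>zigzag\<close> is continuous with period \<open>2\<close>, is \<open>0\<close> on \<open>[0, 1/3]\<close> and
  \<open>1\<close> on \<open>[2/3, 1]\<close>, so \<open>zigzag (3 ^ m * t)\<close> reads off the \<open>m\<close>-th digit of a point of the Cantor set.
\<close>

definition zigzag :: "real \<Rightarrow> real" where
  "zigzag t = max 0 (min 1 (1/2 - cos (pi * t)))"

lemma ternary_geometric_sums: "(\<lambda>n. 2 * (1/3::real) ^ Suc n) sums 1"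
  using sums_mult[OF geometric_sums[of "1/3::real"], of "2/3"] by simp

text \<open>After multiplication by \<open>3 ^ m\<close> the digits before the \<open>m\<close>-th
  contribute an even integer, which the period \<open>2\<close> removes. The \<open>m\<close>-th
  digit contributes \<open>0\<close> or \<open>2/3\<close>, and the tail \<open>u\<close> lies
  between \<open>0\<close> and \<open>1/3\<close>, so the argument falls into one of the two
  intervals where \<open>zigzag\<close> is constant.\<close>

lemma zigzag_digit:
  assumes "\<And>n. \<epsilon> n \<le> (1::nat)"
  shows "zigzag (3 ^ m * (\<Sum>n. 2 * real (\<epsilon> n) * (1/3) ^ Suc n)) = real (\<epsilon> m)"
proof -
  define g where "g n = 2 * real (\<epsilon> n) * (1/3::real) ^ Suc n" for n
  note geo = ternary_geometric_sums
  have "real (\<epsilon> n) \<le> 1" for n using assms[of n] by linarith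
  then have g: "0 \<le> g n" "g n \<le> 2 * (1/3) ^ Suc n" for n
    unfolding g_def by (auto intro!: mult_right_mono)
  have sg: "summable g" by (rule suminf_between(1)[OF g geo])
  define u where "u = (\<Sum>n. 3 ^ m * g (n + Suc m))"
  have "3 ^ m * g (n + Suc m) \<le> (1/3) * (2 * (1/3) ^ Suc n)" for n
  proof -
    have "3 ^ m * g (n + Suc m) \<le> 3 ^ m * (2 * (1/3) ^ Suc (n + Suc m))"
      by (rule mult_left_mono[OF g(2)]) simp
    also have "\<dots> = (1/3) * (2 * (1/3::real) ^ Suc n)"
      by (simp add: power_add power_one_over field_simps)
    finally show ?thesis .
  qed
  then have u: "0 \<le> u" "u \<le> 1/3"
    unfolding u_def using suminf_between(2,3)[of "\<lambda>n. 3 ^ m * g (n + Suc m)", OF _ _ sums_mult[OF geo, of "1/3"]] g(1)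
    by auto
  have "\<exists>k::nat. 3 ^ m * (\<Sum>n<m. g n) = 2 * real k"
  proof (induction m)
    case (Suc m)
    then obtain k where k: "3 ^ m * (\<Sum>n<m. g n) = 2 * real k" by blast
    have "3 ^ Suc m * (\<Sum>n<Suc m. g n) = 3 * (3 ^ m * (\<Sum>n<m. g n)) + 3 ^ Suc m * g m"
      by (simp add: algebra_simps)
    also have "\<dots> = 2 * real (3 * k + \<epsilon> m)"
      unfolding k by (simp add: g_def power_one_over)
    finally show ?case by blast
  qed (simp add: exI[of _ 0])
  then obtain k :: nat where k: "3 ^ m * (\<Sum>n<m. g n) = 2 * real k" ..
  have "suminf g = (\<Sum>n. g (n + Suc m)) + (\<Sum>n<Suc m. g n)"
    by (rule suminf_split_initial_segment[OF sg])
  then have "3 ^ m * suminf g = u + 3 ^ m * g m + 2 * real k"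
    unfolding u_def k[symmetric]
    using suminf_mult[OF iffD2[OF summable_iff_shift sg], of "3 ^ m" "Suc m"] by (simp add: algebra_simps)
  also have "3 ^ m * g m = 2 * real (\<epsilon> m) / 3"
    unfolding g_def by (simp add: power_one_over)
  finally have eq: "3 ^ m * suminf g = (u + 2 * real (\<epsilon> m) / 3) + 2 * real k" by simp
  have "pi * (3 ^ m * suminf g) = pi * (u + 2 * real (\<epsilon> m) / 3) + 2 * real k * pi"
    unfolding eq by (simp only: algebra_simps)
  then have c: "cos (pi * (3 ^ m * suminf g)) = cos (pi * (u + 2 * real (\<epsilon> m) / 3))"
    by (simp only: cos_add cos_2npi sin_2npi mult_1_right mult_zero_right diff_zero)
  consider "\<epsilon> m = 0" | "\<epsilon> m = 1" using assms[of m] by linarith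
  then show ?thesis
  proof cases
    case 1
    have "cos (pi / 3) \<le> cos (pi * u)"
      using u pi_gt_zero by (intro cos_monotone_0_pi_le) (auto simp: field_simps)
    then show ?thesis using 1 c unfolding zigzag_def g_def by (simp add: cos_60)
  next
    case 2
    have "cos (pi * (u + 2/3)) \<le> cos (2/3 * pi)"
      using u pi_gt_zero by (intro cos_monotone_0_pi_le) (auto simp: field_simps)
    also have "\<dots> = - 1/2" using cos_120 by (simp add: mult.commute)
    finally show ?thesis using 2 c unfolding zigzag_def g_def by simp
  qed
qed

text \<open>Coordinate \<open>i\<close> rebuilds a number from the binary digits that
  \<open>zigzag\<close> reads at the positions \<open>prod_encode (i, k)\<close>. Different
  coordinates read disjoint positions, so all of them can be prescribed at once. Continuity comes
  from uniform convergence of the series.\<close>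

lemma hilbert_cube_curve:
  obtains g :: "nat \<Rightarrow> real \<Rightarrow> real"
  where "\<And>i. continuous_on UNIV (g i)" "\<And>i t. 0 \<le> g i t" "\<And>i t. g i t \<le> 1"
    and "\<And>y. (\<And>i. 0 \<le> y i \<and> y i \<le> 1) \<Longrightarrow> \<exists>t\<in>{0..1}. \<forall>i. g i t = y i"
proof -
  define h where "h i t k = zigzag (3 ^ prod_encode (i, k) * t) * (1/2) ^ Suc k" for i t k
  define g where "g i t = (\<Sum>k. h i t k)" for i t
  have h: "0 \<le> h i t k" "h i t k \<le> (1/2) ^ Suc k" for i t k
    unfolding h_def zigzag_def by (auto intro!: mult_left_le_one_le)
  note geo = power_half_series
  have lim: "uniform_limit UNIV (\<lambda>n t. \<Sum>k<n. h i t k) (g i) sequentially" for i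
    unfolding g_def
    by (rule Weierstrass_m_test[where M="\<lambda>k. (1/2) ^ Suc k"])
       (use h sums_summable[OF geo] in auto)
  show ?thesis
  proof (rule that[of g])
    show "continuous_on UNIV (g i)" for i
      by (rule uniform_limit_theorem[OF _ lim])
         (auto simp: h_def zigzag_def intro!: always_eventually continuous_intros)
    show "0 \<le> g i t" "g i t \<le> 1" for i t
      unfolding g_def using suminf_between[OF h geo] by auto
    fix y :: "nat \<Rightarrow> real" assume "\<And>i. 0 \<le> y i \<and> y i \<le> 1"
    then have "\<exists>\<epsilon>::nat \<Rightarrow> nat. (\<forall>k. \<epsilon> k \<le> 1) \<and> (\<lambda>k. real (\<epsilon> k) * (1/2) ^ Suc k) sums y i" for i
      using binary_digits[of "y i"] \<open>\<And>i. 0 \<le> y i \<and> y i \<le> 1\<close>[of i] by metis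
    then obtain \<epsilon> :: "nat \<Rightarrow> nat \<Rightarrow> nat"
      where \<epsilon>: "\<And>i k. \<epsilon> i k \<le> 1" "\<And>i. (\<lambda>k. real (\<epsilon> i k) * (1/2) ^ Suc k) sums y i"
      by metis
    \<comment> \<open>The digits of all coordinates are interleaved into one sequence along the
      pairing function, and \<open>t\<close> is the point of the Cantor set with these
      digits.\<close>
    define \<delta> where "\<delta> n = case_prod \<epsilon> (prod_decode n)" for n
    have \<delta>: "\<delta> n \<le> 1" for n using \<epsilon>(1) unfolding \<delta>_def by (auto split: prod.splits)
    define t where "t = (\<Sum>n. 2 * real (\<delta> n) * (1/3) ^ Suc n)"
    have "h i t = (\<lambda>k. real (\<epsilon> i k) * (1/2) ^ Suc k)" for i
      using zigzag_digit[OF \<delta>, of "prod_encode (i, _)"] unfolding h_def t_def \<delta>_def by (auto simp: fun_eq_iff)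
    then have gy: "g i t = y i" for i
      unfolding g_def using sums_unique[OF \<epsilon>(2)] by metis
    have "real (\<delta> n) \<le> 1" for n using \<delta>[of n] by linarith
    then have b: "0 \<le> 2 * real (\<delta> n) * (1/3) ^ Suc n"
      "2 * real (\<delta> n) * (1/3) ^ Suc n \<le> 2 * (1/3::real) ^ Suc n" for n
      by (auto intro!: mult_right_mono)
    have "0 \<le> t" "t \<le> 1" unfolding t_def using suminf_between[OF b ternary_geometric_sums] by auto
    then show "\<exists>t\<in>{0..1}. \<forall>i. g i t = y i" using gy by (intro bexI[of _ t]) auto
  qed
qed

subsection \<open>Martingale couplings from affine dominance\<close>

text \<open>
  Minimise the sum of squared expectations up to an error: mixing a near-minimiser \<open>p\<close> with a point mass
  at the \<open>s\<close> supplied for the weights \<open>r j = E\<^sub>p (c j)\<close> would decrease a positive infimum.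
\<close>

lemma approximate_alternative:
  fixes c :: "'j \<Rightarrow> 's \<Rightarrow> real"
  assumes J: "finite J"
    and bdd: "\<And>j s. j \<in> J \<Longrightarrow> s \<in> S \<Longrightarrow> \<bar>c j s\<bar> \<le> B"
    and alt: "\<And>r \<delta>. \<delta> > 0 \<Longrightarrow> \<exists>s\<in>S. (\<Sum>j\<in>J. r j * c j s) \<le> \<delta>"
    and "\<epsilon> > 0"
  shows "\<exists>p. finite (set_pmf p) \<and> set_pmf p \<subseteq> S \<and> (\<forall>j\<in>J. \<bar>measure_pmf.expectation p (c j)\<bar> < \<epsilon>)"
proof (rule ccontr)
  assume neg: "\<not> ?thesis"
  define P where "P = {p :: 's pmf. finite (set_pmf p) \<and> set_pmf p \<subseteq> S}"
  define E where "E p j = measure_pmf.expectation p (c j)" for p j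
  define Q where "Q p = (\<Sum>j\<in>J. (E p j)\<^sup>2)" for p
  define K where "K = real (card J) * B\<^sup>2"
  obtain s0 where s0: "s0 \<in> S" using alt[of 1] by auto
  have "return_pmf s0 \<in> P" using s0 by (auto simp: P_def)
  then have ne: "Q ` P \<noteq> {}" by auto
  have bb: "bdd_below (Q ` P)" by (rule bdd_belowI[of _ 0]) (auto simp: Q_def sum_nonneg)
  have big: "\<epsilon>\<^sup>2 \<le> Q p" if p: "p \<in> P" for p
  proof -
    obtain j where j: "j \<in> J" "\<epsilon> \<le> \<bar>E p j\<bar>" using neg p by (auto simp: P_def E_def not_less)
    have "\<epsilon>\<^sup>2 \<le> (E p j)\<^sup>2" using j(2) \<open>\<epsilon> > 0\<close> by (metis abs_le_square_iff abs_of_pos)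
    also have "\<dots> \<le> Q p" unfolding Q_def using j J by (intro member_le_sum) auto
    finally show ?thesis .
  qed
  \<comment> \<open>The infimum is positive because, by the negated claim, every admissible
    \<open>p\<close> violates some constraint by at least \<epsilon>.\<close>
  define q where "q = Inf (Q ` P)"
  have "\<epsilon>\<^sup>2 \<le> q" unfolding q_def using big ne by (intro cINF_greatest) auto
  then have q: "q > 0" using \<open>\<epsilon> > 0\<close> by (smt (verit) zero_less_power)
  have qle: "q \<le> Q p" if "p \<in> P" for p unfolding q_def using bb that by (intro cINF_lower) auto
  have EB: "\<bar>E p j\<bar> \<le> B" if "p \<in> P" "j \<in> J" for p j
  proof -
    have "\<bar>E p j\<bar> \<le> measure_pmf.expectation p (\<lambda>s. \<bar>c j s\<bar>)"
      unfolding E_def by (rule integral_abs_bound)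
    also have "\<dots> \<le> measure_pmf.expectation p (\<lambda>s. B)"
      using that bdd by (intro integral_mono_AE integrable_measure_pmf_finite) (auto simp: P_def AE_measure_pmf_iff)
    finally show ?thesis by simp
  qed
  have sqK: "(\<Sum>j\<in>J. (x j)\<^sup>2) \<le> K" if "\<And>j. j \<in> J \<Longrightarrow> \<bar>x j\<bar> \<le> B" for x
  proof -
    have "(\<Sum>j\<in>J. (x j)\<^sup>2) \<le> (\<Sum>j\<in>J. B\<^sup>2)"
      using that by (intro sum_mono) (metis abs_ge_zero power2_abs power_mono)
    then show ?thesis by (simp add: K_def)
  qed
  have QK: "Q p \<le> K" if "p \<in> P" for p unfolding Q_def by (rule sqK) (use EB that in auto)
  have qK: "q \<le> K" using qle QK \<open>return_pmf s0 \<in> P\<close> by fastforce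
  have K: "K > 0" using q qK by linarith
  \<comment> \<open>With this weight the two second-order terms are at most
    \<open>\<alpha> * q / 4\<close> each and the cross term is at most
    \<open>\<alpha> * q / 2\<close>. The first-order gain is at least
    \<open>2 * \<alpha> * q\<close>, which leaves a net decrease of at least
    \<open>\<alpha> * q\<close>.\<close>
  define \<alpha> where "\<alpha> = q / (4 * K)"
  have \<alpha>: "0 < \<alpha>" "\<alpha> \<le> 1" using q K qK by (auto simp: \<alpha>_def field_simps)
  have \<alpha>K: "\<alpha> * K = q / 4" using K by (simp add: \<alpha>_def)
  have "q < q + \<alpha> * q" using \<alpha> q by simp
  \<comment> \<open>The allowed excess over the infimum is exactly the guaranteed decrease, so the
    mixture \<open>p'\<close> will fall below \<open>q\<close>.\<close>
  then obtain p where p: "p \<in> P" "Q p < q + \<alpha> * q"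
    using cInf_lessD[OF ne, folded q_def] by blast
  obtain s where s: "s \<in> S" "(\<Sum>j\<in>J. E p j * c j s) \<le> q / 4"
    using alt[of "q / 4" "E p"] q by auto
  define p' where "p' = bind_pmf (bernoulli_pmf \<alpha>) (\<lambda>b. if b then return_pmf s else p)"
  have p': "p' \<in> P" using p(1) s(1) by (auto simp: p'_def P_def set_bind_pmf split: if_splits)
  have Ep': "E p' j = (1 - \<alpha>) * E p j + \<alpha> * c j s" for j
    unfolding p'_def E_def using p(1) \<alpha>
    by (subst pmf_expectation_bind[where A = UNIV]) (auto simp: P_def UNIV_bool)
  have "Q p' = (\<Sum>j\<in>J. (1 - \<alpha>)\<^sup>2 * (E p j)\<^sup>2 + 2 * \<alpha> * (1 - \<alpha>) * (E p j * c j s) + \<alpha>\<^sup>2 * (c j s)\<^sup>2)"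
    unfolding Q_def Ep' by (intro sum.cong) (auto simp: power2_eq_square algebra_simps)
  also have "\<dots> = (1 - \<alpha>)\<^sup>2 * Q p + 2 * \<alpha> * (1 - \<alpha>) * (\<Sum>j\<in>J. E p j * c j s) + \<alpha>\<^sup>2 * (\<Sum>j\<in>J. (c j s)\<^sup>2)"
    unfolding Q_def by (simp add: sum.distrib sum_distrib_left)
  also have "\<dots> \<le> (1 - \<alpha>)\<^sup>2 * Q p + 2 * \<alpha> * (1 - \<alpha>) * (q / 4) + \<alpha>\<^sup>2 * K"
    using s \<alpha> bdd by (intro add_mono mult_left_mono sqK) auto
  also have "\<dots> = Q p - 2 * \<alpha> * Q p + \<alpha>\<^sup>2 * Q p + \<alpha> * q / 2 - \<alpha>\<^sup>2 * q / 2 + \<alpha> * (\<alpha> * K)"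
    by (simp add: power2_eq_square algebra_simps)
  also have "\<dots> \<le> Q p - 2 * \<alpha> * q + \<alpha> * (q / 4) + \<alpha> * q / 2 - 0 + \<alpha> * (q / 4)"
  proof -
    have "\<alpha>\<^sup>2 * Q p \<le> \<alpha>\<^sup>2 * K" using QK[OF p(1)] by (intro mult_left_mono) auto
    also have "\<dots> = \<alpha> * (q / 4)" using \<alpha>K by (simp add: power2_eq_square)
    finally have "\<alpha>\<^sup>2 * Q p \<le> \<alpha> * (q / 4)" .
    moreover have "\<alpha> * q \<le> \<alpha> * Q p" using qle[OF p(1)] \<alpha> by (intro mult_left_mono) auto
    moreover have "0 \<le> \<alpha>\<^sup>2 * q / 2" using q by simp
    ultimately show ?thesis unfolding \<alpha>K by linarith
  qed
  also have "\<dots> = Q p - \<alpha> * q" by (simp add: algebra_simps)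
  also have "\<dots> < q" using p(2) by simp
  finally show False using qle[OF p'] by simp
qed

lemma integrable_continuous_compact_support:
  fixes f :: "'b::topological_space \<Rightarrow> real"
  assumes "prob_space M" "sets M = sets borel" "continuous_on UNIV f" "compact C" "AE x in M. x \<in> C"
  shows "integrable M f"
proof -
  interpret prob_space M by fact
  have "compact (f ` C)"
    using assms(3,4) by (intro compact_continuous_image) (auto intro: continuous_on_subset)
  then obtain B where "\<And>x. x \<in> C \<Longrightarrow> norm (f x) \<le> B"
    by (meson bounded_iff compact_imp_bounded imageI)
  then have "AE x in M. norm (f x) \<le> B" using assms(5) by auto
  moreover have "f \<in> borel_measurable M"
    unfolding measurable_cong_sets[OF assms(2) refl] using assms(3) by (rule borel_measurable_continuous_onI)
  ultimately show ?thesis by (rule integrable_const_bound)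
qed

lemma continuous_on_Max_image:
  fixes f :: "'i \<Rightarrow> 'b::topological_space \<Rightarrow> real"
  assumes "finite N" "N \<noteq> {}" "\<And>i. i \<in> N \<Longrightarrow> continuous_on A (f i)"
  shows "continuous_on A (\<lambda>x. Max ((\<lambda>i. f i x) ` N))"
  using assms
proof (induction N rule: finite_ne_induct)
  case (insert i N)
  have "continuous_on A (\<lambda>x. max (f i x) (Max ((\<lambda>i. f i x) ` N)))"
    using insert by (intro continuous_on_max) auto
  then show ?case using insert by simp
qed simp

text \<open>The box replaces the simplex because its coordinates vary independently, which lets the
  Hilbert cube curve run through all pairs of its points.\<close>

definition unit_box :: "(real ^ 'a::finite) set" where
  "unit_box = {x. \<forall>i. 0 \<le> x $ i \<and> x $ i \<le> 1}"

lemma compact_unit_box: "compact (unit_box :: (real ^ 'a::finite) set)"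
proof -
  have *: "(unit_box :: (real ^ 'a) set) = cbox 0 1" by (auto simp: unit_box_def mem_box_cart)
  show ?thesis unfolding * by (rule compact_cbox)
qed

abbreviation affine_max :: "(real \<times> (real ^ 'a::finite)) set \<Rightarrow> real ^ 'a \<Rightarrow> real" where
  "affine_max N x \<equiv> Max ((\<lambda>(\<alpha>, w). \<alpha> + w \<bullet> x) ` N)"

lemma continuous_on_affine_max:
  assumes "finite N" "N \<noteq> {}"
  shows "continuous_on A (affine_max N)"
proof -
  have "continuous_on A (\<lambda>x. Max ((\<lambda>p. fst p + snd p \<bullet> x) ` N))"
    by (rule continuous_on_Max_image[OF assms]) (intro continuous_intros)
  then show ?thesis by (simp add: case_prod_beta')
qed

text \<open>Otherwise each \<open>y\<close> in the box yields an affine function \<open>l y\<close>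
  that lies below \<open>a\<close> on the box and above \<open>\<kappa> - \<delta> / 2 - b\<close>
  near \<open>y\<close>. By compactness finitely many of them suffice. Their maximum has integral at
  most that of \<open>a\<close> under \<open>F\<close>, yet at least \<open>\<delta> / 2\<close>
  more than that under \<open>G\<close>, against \<open>dom\<close>.\<close>

lemma potentials_violated:
  fixes F G :: "(real ^ 'a::finite) measure"
  assumes F: "prob_space F" "sets F = sets borel" "AE x in F. x \<in> unit_box"
    and G: "prob_space G" "sets G = sets borel" "AE x in G. x \<in> unit_box"
    and dom: "\<And>N. finite N \<Longrightarrow> N \<noteq> {} \<Longrightarrow> (\<integral>x. affine_max N x \<partial>G) \<le> (\<integral>x. affine_max N x \<partial>F)"
    and a: "continuous_on UNIV a" and b: "continuous_on UNIV b"
    and "\<delta> > 0"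
  shows "\<exists>x\<in>unit_box. \<exists>y\<in>unit_box.
    (a x - (\<integral>x. a x \<partial>F)) + (b y - (\<integral>x. b x \<partial>G)) + (x - y) \<bullet> h y \<le> \<delta>"
proof (rule ccontr)
  assume neg: "\<not> ?thesis"
  interpret F: prob_space F by fact
  interpret G: prob_space G by fact
  \<comment> \<open>This constant collects every term free of \<open>x\<close> and \<open>y\<close>,
    so that the negated claim becomes \<open>l y x < a x\<close>, while
    \<open>l y y = \<kappa> - b y\<close>.\<close>
  define \<kappa> where "\<kappa> = \<delta> + (\<integral>x. a x \<partial>F) + (\<integral>x. b x \<partial>G)"
  define l where "l y x = (\<kappa> - b y + y \<bullet> h y) + (- h y) \<bullet> x" for x y
  have la: "l y x \<le> a x" if "x \<in> unit_box" "y \<in> unit_box" for x y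
  proof -
    have "\<not> (a x - (\<integral>x. a x \<partial>F)) + (b y - (\<integral>x. b x \<partial>G)) + (x - y) \<bullet> h y \<le> \<delta>"
      using neg that by blast
    then show ?thesis
      by (simp add: l_def \<kappa>_def inner_diff_right inner_commute[of _ "h y"])
  qed
  \<comment> \<open>The slack \<open>\<delta> / 2\<close> makes the inequality strict at
    \<open>x = y\<close>, so \<open>U y\<close> is an open neighbourhood of
    \<open>y\<close>.\<close>
  define U where "U y = {x. \<kappa> - \<delta> / 2 - b x < l y x}" for y
  have "open (U y)" for y
    unfolding U_def l_def by (intro open_Collect_less continuous_intros b)
  moreover have "y \<in> U y" for y
    unfolding U_def l_def using \<open>\<delta> > 0\<close> by (simp add: inner_commute)
  then have "unit_box \<subseteq> (\<Union>y\<in>unit_box. U y)" by blast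
  ultimately obtain N0 where N0: "N0 \<subseteq> unit_box" "finite N0" "unit_box \<subseteq> (\<Union>y\<in>N0. U y)"
    by (meson compactE_image compact_unit_box)
  have "0 \<in> (unit_box :: (real ^ 'a) set)" by (simp add: unit_box_def)
  then have "N0 \<noteq> {}" using N0(3) by auto
  define N where "N = (\<lambda>y. (\<kappa> - b y + y \<bullet> h y, - h y)) ` N0"
  have N: "finite N" "N \<noteq> {}" using N0(2) \<open>N0 \<noteq> {}\<close> by (auto simp: N_def)
  have eq: "affine_max N x = Max ((\<lambda>y. l y x) ` N0)" for x
    by (simp add: N_def image_image l_def)
  have up: "affine_max N x \<le> a x" if "x \<in> unit_box" for x
    unfolding eq using N0 \<open>N0 \<noteq> {}\<close> la that by (subst Max_le_iff) auto
  have low: "\<kappa> - \<delta> / 2 - b x \<le> affine_max N x" if "x \<in> unit_box" for x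
  proof -
    obtain y where "y \<in> N0" "x \<in> U y" using N0(3) \<open>x \<in> unit_box\<close> by auto
    moreover have "l y x \<le> affine_max N x"
      unfolding eq using N0(2) \<open>y \<in> N0\<close> by (intro Max_ge) auto
    ultimately show ?thesis by (simp add: U_def)
  qed
  note intF = integrable_continuous_compact_support[OF F(1,2) _ compact_unit_box F(3)]
  note intG = integrable_continuous_compact_support[OF G(1,2) _ compact_unit_box G(3)]
  note cm = continuous_on_affine_max[OF N]
  have "\<kappa> - \<delta> / 2 - (\<integral>x. b x \<partial>G) = (\<integral>x. \<kappa> - \<delta> / 2 - b x \<partial>G)"
    using intG[OF b] by (simp add: G.prob_space)
  also have "\<dots> \<le> (\<integral>x. affine_max N x \<partial>G)"
  proof (rule integral_mono_AE)
    show "AE x in G. \<kappa> - \<delta> / 2 - b x \<le> affine_max N x" using G(3) low by auto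
  qed (use intG[OF cm] intG[OF b] in auto)
  also have "\<dots> \<le> (\<integral>x. affine_max N x \<partial>F)" by (rule dom[OF N])
  also have "\<dots> \<le> (\<integral>x. a x \<partial>F)"
  proof (rule integral_mono_AE)
    show "AE x in F. affine_max N x \<le> a x" using F(3) up by auto
  qed (use intF[OF cm] intF[OF a] in auto)
  finally show False using \<open>\<delta> > 0\<close> by (simp add: \<kappa>_def)
qed

section \<open>From approximate couplings to a mean-preserving spread\<close>

lemma borel_measurable_component [measurable (raw)]:
  fixes f :: "'b \<Rightarrow> real ^ 'a::finite"
  assumes "f \<in> borel_measurable M"
  shows "(\<lambda>\<omega>. f \<omega> $ i) \<in> borel_measurable M"
  by (rule measurable_compose[OF assms]) (intro borel_measurable_continuous_onI continuous_intros)

text \<open>The definition of a spread fixes the type of the sample space, so the pair is replaced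
  by the coordinate maps under its joint law \<open>L\<close>. Events of the sigma-algebra generated
  by the second coordinate are preimages of Borel sets, and \<open>mart\<close> supplies the
  defining identity of conditional expectation on them.\<close>

lemma mean_preserving_spreadI:
  fixes X Y :: "'b \<Rightarrow> real ^ 'a::finite"
  assumes "prob_space M"
    and X: "X \<in> borel_measurable M" "\<And>i. integrable M (\<lambda>\<omega>. X \<omega> $ i)"
    and Y: "Y \<in> borel_measurable M" "\<And>i. integrable M (\<lambda>\<omega>. Y \<omega> $ i)"
    and mart: "\<And>B i. B \<in> sets borel \<Longrightarrow>
        (\<integral>\<omega>. indicator B (Y \<omega>) * X \<omega> $ i \<partial>M) = (\<integral>\<omega>. indicator B (Y \<omega>) * Y \<omega> $ i \<partial>M)"
  shows "distr M borel X \<succeq> distr M borel Y"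
proof -
  define L where "L = distr M borel (\<lambda>\<omega>. (X \<omega>, Y \<omega>))"
  note [measurable] = X(1) Y(1)
  have XY: "(\<lambda>\<omega>. (X \<omega>, Y \<omega>)) \<in> M \<rightarrow>\<^sub>M borel" by measurable
  have [measurable_cong, simp]: "sets L = sets borel" "space L = UNIV" by (simp_all add: L_def)
  interpret M: prob_space M by fact
  interpret L: prob_space L unfolding L_def by (rule M.prob_space_distr[OF XY])
  have fs: "fst \<in> borel_measurable L" "snd \<in> borel_measurable L"
    unfolding measurable_cong_sets[OF \<open>sets L = sets borel\<close> refl]
    by (auto intro!: borel_measurable_continuous_onI continuous_intros)
  have [measurable]: "(\<lambda>\<omega>. fst \<omega> $ i) \<in> borel_measurable (borel :: ((real ^ 'a) \<times> (real ^ 'a)) measure)"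
    "(\<lambda>\<omega>. snd \<omega> $ i) \<in> borel_measurable (borel :: ((real ^ 'a) \<times> (real ^ 'a)) measure)" for i
    by (auto intro!: borel_measurable_continuous_onI continuous_intros)
  have sub: "subalgebra L (vimage_algebra (space L) snd borel)"
    unfolding subalgebra_def
    by (auto simp: sets_vimage_algebra2 intro!: measurable_sets[OF fs(2), simplified])
  interpret A: finite_measure_subalgebra L "vimage_algebra (space L) snd borel"
    by unfold_locales (rule sub)
  have "AE \<omega> in L. real_cond_exp L (vimage_algebra (space L) snd borel) (\<lambda>\<omega>'. fst \<omega>' $ i) \<omega> = snd \<omega> $ i" for i
  proof (rule A.real_cond_exp_charact)
    show "integrable L (\<lambda>\<omega>. fst \<omega> $ i)" "integrable L (\<lambda>\<omega>. snd \<omega> $ i)"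
      unfolding L_def using X(2) Y(2) by (simp_all add: integrable_distr_eq[OF XY])
    have "snd \<in> vimage_algebra (space L) snd borel \<rightarrow>\<^sub>M borel"
      by (rule measurable_vimage_algebra1) auto
    then show "(\<lambda>\<omega>. snd \<omega> $ i) \<in> borel_measurable (vimage_algebra (space L) snd borel)"
      by (rule measurable_compose) measurable
    fix A assume "A \<in> sets (vimage_algebra (space L) snd borel)"
    then obtain B where B: "B \<in> sets borel" "A = snd -` B"
      by (auto simp: sets_vimage_algebra2)
    have [measurable]: "(\<lambda>\<omega>. indicator B (snd \<omega>) :: real) \<in> borel_measurable (borel :: ((real ^ 'a) \<times> (real ^ 'a)) measure)"
      by (rule measurable_compose[OF _ borel_measurable_indicator[OF B(1)]])
        (intro borel_measurable_continuous_onI continuous_intros)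
    have ind: "indicator A \<omega> = indicator B (snd \<omega>)" for \<omega> using B by (auto split: split_indicator)
    show "(LINT \<omega>:A|L. fst \<omega> $ i) = (LINT \<omega>:A|L. snd \<omega> $ i)"
      unfolding set_lebesgue_integral_def ind unfolding L_def
      using mart[OF B(1), of i] by (simp add: integral_distr[OF XY])
  qed
  then have "prob_space L \<and> fst \<in> borel_measurable L \<and> snd \<in> borel_measurable L \<and>
      distr L borel fst = distr M borel X \<and> distr L borel snd = distr M borel Y \<and>
      (\<forall>i. AE \<omega> in L. real_cond_exp L (vimage_algebra (space L) snd borel) (\<lambda>\<omega>'. fst \<omega>' $ i) \<omega> = snd \<omega> $ i)"
    using L.prob_space_axioms fs by (auto simp: L_def distr_distr comp_def XY)
  then show ?thesis unfolding mean_preserving_spread_def by blast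
qed


text \<open>This is the hard half of Strassen's theorem. Pulled back along the curve, every
  constraint is a bounded continuous function on the line, so its expectation passes to weak limits
  and the limit law satisfies all constraints exactly.\<close>

lemma affine_domination_imp_mean_preserving_spread:
  fixes F G :: "(real ^ 'a::finite) measure"
  assumes F: "prob_space F" "sets F = sets borel" "AE x in F. x \<in> unit_box"
    and G: "prob_space G" "sets G = sets borel" "AE x in G. x \<in> unit_box"
    and dom: "\<And>N. finite N \<Longrightarrow> N \<noteq> {} \<Longrightarrow> (\<integral>x. affine_max N x \<partial>G) \<le> (\<integral>x. affine_max N x \<partial>F)"
  shows "F \<succeq> G"
proof -
  obtain f :: "nat \<Rightarrow> real ^ 'a \<Rightarrow> real"
    where fc: "\<And>j. continuous_on UNIV (f j)" and f01: "\<And>j x. 0 \<le> f j x" "\<And>j x. f j x \<le> 1"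
      and det: "\<And>M N. \<lbrakk>finite_measure M; finite_measure N; sets M = sets borel; sets N = sets borel;
            \<And>j. (\<integral>x. f j x \<partial>M) = (\<integral>x. f j x \<partial>N)\<rbrakk> \<Longrightarrow> M = N"
    using countable_measure_determining by blast
  obtain g :: "nat \<Rightarrow> real \<Rightarrow> real"
    where gc: "\<And>i. continuous_on UNIV (g i)" and g01: "\<And>i t. 0 \<le> g i t" "\<And>i t. g i t \<le> 1"
      and gs: "\<And>y. (\<And>i. 0 \<le> y i \<and> y i \<le> 1) \<Longrightarrow> \<exists>t\<in>{0..1}. \<forall>i. g i t = y i"
    using hilbert_cube_curve by blast
  \<comment> \<open>The even coordinates of the curve carry \<open>X\<close> and the odd ones
    \<open>Y\<close>, so one parameter reaches every pair of points of the box.\<close>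
  define X :: "real \<Rightarrow> real ^ 'a" where "X t = (\<chi> i. g (2 * to_nat i) t)" for t
  define Y :: "real \<Rightarrow> real ^ 'a" where "Y t = (\<chi> i. g (2 * to_nat i + 1) t)" for t
  have XYc: "continuous_on UNIV X" "continuous_on UNIV Y"
    unfolding X_def Y_def by (auto intro!: continuous_on_vec_lambda gc)
  have X01: "0 \<le> X t $ i" "X t $ i \<le> 1" and Y01: "0 \<le> Y t $ i" "Y t $ i \<le> 1" for t i
    by (simp_all add: X_def Y_def g01)
  have surj: "\<exists>t\<in>{0..1}. X t = x \<and> Y t = y" if "x \<in> unit_box" "y \<in> unit_box" for x y
  proof -
    define z where "z n = (if even n then x else y) $ (from_nat (n div 2))" for n :: nat
    have "\<exists>t\<in>{0..1}. \<forall>n. g n t = z n"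
      by (rule gs) (use that in \<open>auto simp: z_def unit_box_def\<close>)
    then obtain t where "t \<in> {0..1}" "\<And>n. g n t = z n" by blast
    then show ?thesis by (intro bexI[of _ t]) (auto simp: X_def Y_def z_def vec_eq_iff)
  qed
  \<comment> \<open>Each \<open>f j\<close> gives three kinds of constraint: \<open>Inl i\<close>
    tests component \<open>i\<close> of the martingale property against \<open>f j (Y t)\<close>,
    \<open>Inr True\<close> tests the marginal \<open>F\<close>, and \<open>Inr False\<close> tests
    the marginal \<open>G\<close>.\<close>
  define c :: "nat \<times> ('a + bool) \<Rightarrow> real \<Rightarrow> real" where
    "c k t = (case k of (j, Inl i) \<Rightarrow> (X t - Y t) $ i * f j (Y t)
        | (j, Inr u) \<Rightarrow> if u then f j (X t) - (\<integral>x. f j x \<partial>F) else f j (Y t) - (\<integral>x. f j x \<partial>G))" for k t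
  have fXY: "continuous_on UNIV (\<lambda>t. f j (X t))" "continuous_on UNIV (\<lambda>t. f j (Y t))" for j
    using continuous_on_compose2[OF fc XYc(1)] continuous_on_compose2[OF fc XYc(2)] by auto
  have cc: "continuous_on UNIV (c k)" for k
  proof -
    obtain j v where k: "k = (j, v)" by (cases k)
    show ?thesis
    proof (cases v)
      case (Inr u)
      then show ?thesis unfolding c_def k by (cases u) (auto intro!: continuous_intros fXY)
    qed (auto simp: c_def k intro!: continuous_intros XYc fXY)
  qed
  interpret F: prob_space F by fact
  interpret G: prob_space G by fact
  note intF = integrable_continuous_compact_support[OF F(1,2) _ compact_unit_box F(3)]
  note intG = integrable_continuous_compact_support[OF G(1,2) _ compact_unit_box G(3)]
  have fF: "0 \<le> (\<integral>x. f j x \<partial>F)" "(\<integral>x. f j x \<partial>F) \<le> 1" for j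
    using integral_mono[OF intF[OF fc, of j], of "\<lambda>_. 1"] f01 by (auto simp: F.prob_space)
  have fG: "0 \<le> (\<integral>x. f j x \<partial>G)" "(\<integral>x. f j x \<partial>G) \<le> 1" for j
    using integral_mono[OF intG[OF fc, of j], of "\<lambda>_. 1"] f01 by (auto simp: G.prob_space)
  have cb: "\<bar>c k t\<bar> \<le> 1" for k t
  proof -
    obtain j v where k: "k = (j, v)" by (cases k)
    have "\<bar>(X t - Y t) $ i * f j (Y t)\<bar> \<le> 1" for i
    proof -
      have "\<bar>(X t - Y t) $ i\<bar> \<le> 1" using X01[of t i] Y01[of t i] by simp
      then show ?thesis unfolding abs_mult using f01[of j "Y t"] by (intro mult_le_one) auto
    qed
    moreover have "\<bar>f j x - (\<integral>x. f j x \<partial>F)\<bar> \<le> 1" "\<bar>f j x - (\<integral>x. f j x \<partial>G)\<bar> \<le> 1" for x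
      using f01[of j x] fF[of j] fG[of j] by linarith+
    ultimately show ?thesis unfolding c_def k by (cases v) auto
  qed
  have alt: "\<exists>t\<in>{0..1}. (\<Sum>k\<in>{..<n} \<times> UNIV. r k * c k t) \<le> \<delta>" if "\<delta> > 0" for n r \<delta>
  proof -
    \<comment> \<open>Grouping an arbitrary weighted sum of constraints by kind produces the two
      potentials and the vector field of \<open>potentials_violated\<close>.\<close>
    define a where "a x = (\<Sum>j<n. r (j, Inr True) * f j x)" for x
    define b where "b x = (\<Sum>j<n. r (j, Inr False) * f j x)" for x
    define h where "h y = (\<chi> i. \<Sum>j<n. r (j, Inl i) * f j y)" for y
    have "continuous_on UNIV a" "continuous_on UNIV b"
      unfolding a_def b_def by (intro continuous_intros fc)+
    from potentials_violated[OF F G dom this \<open>\<delta> > 0\<close>, where h = h]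
    obtain x y where xy: "x \<in> unit_box" "y \<in> unit_box"
      "(a x - (\<integral>x. a x \<partial>F)) + (b y - (\<integral>x. b x \<partial>G)) + (x - y) \<bullet> h y \<le> \<delta>"
      by blast
    obtain t where t: "t \<in> {0..1}" "X t = x" "Y t = y" using surj xy(1,2) by blast
    have ia: "(\<integral>x. a x \<partial>F) = (\<Sum>j<n. r (j, Inr True) * (\<integral>x. f j x \<partial>F))"
      unfolding a_def using intF[OF fc] by (subst Bochner_Integration.integral_sum) auto
    have ib: "(\<integral>x. b x \<partial>G) = (\<Sum>j<n. r (j, Inr False) * (\<integral>x. f j x \<partial>G))"
      unfolding b_def using intG[OF fc] by (subst Bochner_Integration.integral_sum) auto
    have "(x - y) \<bullet> h y = (\<Sum>i\<in>UNIV. \<Sum>j<n. r (j, Inl i) * ((x - y) $ i * f j y))"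
      unfolding inner_vec_def h_def by (simp add: sum_distrib_left mult_ac)
    also have "\<dots> = (\<Sum>j<n. \<Sum>i\<in>UNIV. r (j, Inl i) * ((x - y) $ i * f j y))"
      by (rule sum.swap)
    finally have ih: "(x - y) \<bullet> h y = (\<Sum>j<n. \<Sum>i\<in>UNIV. r (j, Inl i) * ((x - y) $ i * f j y))" .
    have "(\<Sum>k\<in>{..<n} \<times> UNIV. r k * c k t) = (\<Sum>j<n. \<Sum>v\<in>UNIV. r (j, v) * c (j, v) t)"
      by (simp add: sum.cartesian_product)
    also have "\<dots> = (\<Sum>j<n. (\<Sum>i\<in>UNIV. r (j, Inl i) * ((x - y) $ i * f j y))
        + (r (j, Inr False) * (f j y - (\<integral>x. f j x \<partial>G)) + r (j, Inr True) * (f j x - (\<integral>x. f j x \<partial>F))))"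
      by (simp add: UNIV_Plus_UNIV[symmetric] sum.Plus UNIV_bool c_def t del: UNIV_Plus_UNIV)
    also have "\<dots> = (a x - (\<integral>x. a x \<partial>F)) + (b y - (\<integral>x. b x \<partial>G)) + (x - y) \<bullet> h y"
      unfolding ia ib ih by (simp add: a_def b_def sum.distrib sum_subtractf right_diff_distrib)
    finally show ?thesis using xy(3) t(1) by (intro bexI[of _ t]) auto
  qed
  \<comment> \<open>The index sets exhaust all constraints while the tolerance shrinks, so the
    expectation of each fixed constraint tends to \<open>0\<close> along the sequence.\<close>
  have "\<exists>p. finite (set_pmf p) \<and> set_pmf p \<subseteq> {0..1} \<and>
      (\<forall>k\<in>{..<n} \<times> UNIV. \<bar>measure_pmf.expectation p (c k)\<bar> < inverse (real (Suc n)))" for n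
    by (rule approximate_alternative[where B = 1]) (use cb alt in auto)
  then obtain p where p: "\<And>n. set_pmf (p n) \<subseteq> {0..1}"
    "\<And>n j v. j < n \<Longrightarrow> \<bar>measure_pmf.expectation (p n) (c (j, v))\<bar> < inverse (real (Suc n))"
    by (metis (no_types, lifting) SigmaI UNIV_I lessThan_iff)
  \<comment> \<open>The image under the identity replaces the discrete sigma-algebra of
    \<open>measure_pmf\<close> by the Borel one.\<close>
  define \<nu> where "\<nu> n = distr (measure_pmf (p n)) borel (\<lambda>x::real. x)" for n
  have rd: "real_distribution (\<nu> n)" for n
    unfolding \<nu>_def by (rule prob_space.real_distribution_distr[OF prob_space_measure_pmf]) simp
  have "tight \<nu>"
    unfolding tight_def
  proof (intro conjI allI impI rd exI)
    \<comment> \<open>All these laws live on \<open>{0..1}\<close>; the half-open interval starts at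
      \<open>-1\<close> so that it contains the point \<open>0\<close>.\<close>
    show "(-1::real) < 1" by simp
    fix \<epsilon> :: real and n assume "\<epsilon> > 0"
    have "measure (\<nu> n) {-1<..1} = measure (measure_pmf (p n)) {-1<..1}"
      unfolding \<nu>_def by (subst measure_distr) auto
    also have "\<dots> = 1"
      using p(1)[of n] by (subst measure_pmf.prob_eq_1) (auto simp: AE_measure_pmf_iff)
    finally show "measure (\<nu> n) {-1<..1} > 1 - \<epsilon>" using \<open>\<epsilon> > 0\<close> by simp
  qed
  then obtain s L where s: "strict_mono s" and L: "real_distribution L"
    and "weak_conv_m (\<nu> \<circ> id \<circ> s) L"
    using tight_imp_convergent_subsubsequence[of \<nu> id] by (auto simp: strict_mono_id)
  then have conv: "weak_conv_m (\<lambda>n. \<nu> (s n)) L" by (simp add: comp_def)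
  interpret L: real_distribution L by fact
  have LU: "measure L UNIV = 1" using L.prob_space by simp
  have Lc: "(\<integral>t. c k t \<partial>L) = 0" for k
  proof (rule LIMSEQ_unique)
    obtain j v where k: "k = (j, v)" by (cases k)
    show "(\<lambda>n. \<integral>t. c k t \<partial>\<nu> (s n)) \<longlonglongrightarrow> (\<integral>t. c k t \<partial>L)"
      by (rule weak_conv_imp_integral_bdd_continuous_conv[OF rd L conv, where B = 1])
        (use cc cb in \<open>auto simp: continuous_on_eq_continuous_at\<close>)
    have eq: "(\<integral>t. c k t \<partial>\<nu> n) = measure_pmf.expectation (p n) (c k)" for n
      unfolding \<nu>_def using cc[of k]
      by (subst integral_distr) (auto intro!: borel_measurable_continuous_onI)
    have "\<bar>\<integral>t. c k t \<partial>\<nu> n\<bar> \<le> inverse (real (Suc n))" if "j < n" for n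
      using p(2)[OF that, of v] eq[of n] by (simp add: k)
    then have "\<forall>\<^sub>F n in sequentially. norm (\<integral>t. c k t \<partial>\<nu> n) \<le> inverse (real (Suc n))"
      by (intro eventually_mono[OF eventually_gt_at_top[of j]]) simp
    from Lim_null_comparison[OF this LIMSEQ_inverse_real_of_nat]
    have "(\<lambda>n. \<integral>t. c k t \<partial>\<nu> n) \<longlonglongrightarrow> 0" .
    from LIMSEQ_subseq_LIMSEQ[OF this s] show "(\<lambda>n. \<integral>t. c k t \<partial>\<nu> (s n)) \<longlonglongrightarrow> 0"
      by (simp add: comp_def)
  qed
  have mL[measurable]: "X \<in> borel_measurable L" "Y \<in> borel_measurable L"
    unfolding measurable_cong_sets[OF L.events_eq_borel refl]
    by (rule borel_measurable_continuous_onI XYc)+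
  have fm[measurable]: "f j \<in> borel_measurable borel" for j
    by (rule borel_measurable_continuous_onI fc)+
  have intb: "integrable L u" if "u \<in> borel_measurable L" "\<And>t. \<bar>u t\<bar> \<le> 1" for u :: "real \<Rightarrow> real"
    using that by (intro L.integrable_const_bound[where B = 1]) auto
  have iXY: "integrable L (\<lambda>t. f j (X t))" "integrable L (\<lambda>t. f j (Y t))" for j
    using f01 by (auto intro!: intb)
  have "distr L borel X = F"
  proof (rule det)
    show "(\<integral>x. f j x \<partial>distr L borel X) = (\<integral>x. f j x \<partial>F)" for j
      using Lc[of "(j, Inr True)"] iXY by (simp add: c_def integral_distr LU)
  qed (use F L.prob_space_distr[OF mL(1)] in \<open>auto simp: prob_space_def\<close>)
  moreover have "distr L borel Y = G"
  proof (rule det)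
    show "(\<integral>x. f j x \<partial>distr L borel Y) = (\<integral>x. f j x \<partial>G)" for j
      using Lc[of "(j, Inr False)"] iXY by (simp add: c_def integral_distr LU)
  qed (use G L.prob_space_distr[OF mL(2)] in \<open>auto simp: prob_space_def\<close>)
  moreover have "distr L borel X \<succeq> distr L borel Y"
  proof (rule mean_preserving_spreadI)
    show "integrable L (\<lambda>\<omega>. X \<omega> $ i)" "integrable L (\<lambda>\<omega>. Y \<omega> $ i)" for i
      using X01 Y01 by (auto intro!: intb borel_measurable_component)
    fix B :: "(real ^ 'a) set" and i assume B[measurable]: "B \<in> sets borel"
    \<comment> \<open>\<open>W Z\<close> assigns to \<open>B\<close> the integral of component
      \<open>i\<close> of \<open>Z\<close> over the event that \<open>Y\<close> lies in
      \<open>B\<close>; it is a finite measure because that component stays between \<open>0\<close>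
      and \<open>1\<close>. Thus \<open>W X = W Y\<close> is the martingale identity for component
      \<open>i\<close>, and the \<open>Inl i\<close> constraints give it by comparison of the
      integrals of all \<open>f j\<close>.\<close>
    define W where "W Z = distr (density L (\<lambda>t. ennreal (Z t $ i))) borel Y" for Z :: "real \<Rightarrow> real ^ 'a"
    have W: "(\<integral>x. u x \<partial>W Z) = (\<integral>t. u (Y t) * Z t $ i \<partial>L)"
      if [measurable]: "Z \<in> borel_measurable L" "u \<in> borel_measurable borel" and "\<And>t. 0 \<le> Z t $ i"
      for u :: "real ^ 'a \<Rightarrow> real" and Z
      unfolding W_def using that(3) by (simp add: integral_distr integral_density mult.commute)
    have fin: "finite_measure (W Z)"
      if [measurable]: "Z \<in> borel_measurable L" and Z: "\<And>t. 0 \<le> Z t $ i" "\<And>t. Z t $ i \<le> 1" for Z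
    proof (rule finite_measureI)
      have "emeasure (W Z) (space (W Z)) = (\<integral>\<^sup>+t. ennreal (Z t $ i) \<partial>L)"
        unfolding W_def by (simp add: emeasure_distr emeasure_density cong: nn_integral_cong)
      also have "\<dots> \<le> (\<integral>\<^sup>+t. 1 \<partial>L)" using Z by (intro nn_integral_mono) (auto simp: ennreal_le_1)
      also have "\<dots> = 1" using L.emeasure_space_1 by simp
      finally show "emeasure (W Z) (space (W Z)) \<noteq> \<infinity>" by (auto simp: top_unique)
    qed
    have "W X = W Y"
    proof (rule det)
      show "sets (W X) = sets borel" "sets (W Y) = sets borel" by (simp_all add: W_def)
      show "(\<integral>x. f j x \<partial>W X) = (\<integral>x. f j x \<partial>W Y)" for j
      proof -
        have "integrable L (\<lambda>t. f j (Y t) * X t $ i)" "integrable L (\<lambda>t. f j (Y t) * Y t $ i)"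
          using f01 X01 Y01 by (auto intro!: intb mult_le_one simp: abs_mult)
        then show ?thesis
          using Lc[of "(j, Inl i)"] X01 Y01 by (simp add: W c_def algebra_simps)
      qed
    qed (use fin X01 Y01 in auto)
    then show "(\<integral>\<omega>. indicator B (Y \<omega>) * X \<omega> $ i \<partial>L) = (\<integral>\<omega>. indicator B (Y \<omega>) * Y \<omega> $ i \<partial>L)"
      using W[OF mL(1) borel_measurable_indicator[OF B] X01(1)]
        W[OF mL(2) borel_measurable_indicator[OF B] Y01(1)] by metis
  qed (use L.prob_space_axioms in auto)
  ultimately show ?thesis by simp
qed

subsection \<open>Spreads and support functions\<close>

abbreviation support_function :: "(real ^ 'a::finite) set \<Rightarrow> real ^ 'a \<Rightarrow> real" where
  "support_function W x \<equiv> (SUP w\<in>W. w \<bullet> x)"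

lemma bdd_above_support_function:
  fixes W :: "(real ^ 'a::finite) set"
  assumes "bounded W"
  shows "bdd_above ((\<lambda>w. w \<bullet> x) ` W)"
proof -
  obtain B where B: "\<And>w. w \<in> W \<Longrightarrow> norm w \<le> B" using assms by (auto simp: bounded_iff)
  have "w \<bullet> x \<le> B * norm x" if "w \<in> W" for w
  proof -
    have "w \<bullet> x \<le> norm w * norm x" by (rule norm_cauchy_schwarz)
    also have "\<dots> \<le> B * norm x" using B[OF that] by (intro mult_right_mono) auto
    finally show ?thesis .
  qed
  then show ?thesis by (auto intro!: bdd_aboveI2)
qed

text \<open>A norm bound on \<open>W\<close> is a common Lipschitz constant for all the linear
  functions, and the supremum inherits it.\<close>

lemma continuous_on_support_function:
  fixes W :: "(real ^ 'a::finite) set"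
  assumes "bounded W" "W \<noteq> {}"
  shows "continuous_on A (support_function W)"
proof -
  obtain B where B: "\<And>w. w \<in> W \<Longrightarrow> norm w \<le> B" "B > 0"
    using assms by (auto simp: bounded_pos)
  have le: "support_function W x \<le> support_function W y + B * dist x y" for x y
  proof (rule cSUP_least[OF assms(2)])
    fix w assume w: "w \<in> W"
    have "w \<bullet> x = w \<bullet> y + w \<bullet> (x - y)" by (simp add: inner_diff_right)
    also have "w \<bullet> y \<le> support_function W y"
      by (rule cSUP_upper[OF w bdd_above_support_function[OF assms(1)]])
    also have "w \<bullet> (x - y) \<le> norm w * norm (x - y)" by (rule norm_cauchy_schwarz)
    also have "\<dots> \<le> B * dist x y"
      unfolding dist_norm using B w by (intro mult_right_mono) auto
    finally show "w \<bullet> x \<le> support_function W y + B * dist x y" by simp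
  qed
  have "B-lipschitz_on A (support_function W)"
  proof (rule lipschitz_onI)
    show "dist (support_function W x) (support_function W y) \<le> B * dist x y" for x y
      using le[of x y] le[of y x] by (simp add: dist_real_def dist_commute abs_le_iff)
  qed (use B in simp)
  then show ?thesis by (rule lipschitz_on_continuous_on)
qed

text \<open>This is conditional Jensen for a supremum of linear functions: almost surely
  \<open>w \<bullet> Y\<close> is the conditional expectation of \<open>w \<bullet> X\<close>, hence
  at most \<open>Z\<close>, the conditional expectation of the support function at \<open>X\<close>.
  Taking the supremum over \<open>w\<close> and integrating gives the claim.\<close>

lemma mean_preserving_spread_imp_support_function_le:
  fixes F G :: "(real ^ 'a::finite) measure"
  assumes "F \<succeq> G" and F: "AE x in F. x \<in> unit_box" and G: "AE x in G. x \<in> unit_box"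
    and W: "bounded W" "W \<noteq> {}"
  shows "(\<integral>x. support_function W x \<partial>G) \<le> (\<integral>x. support_function W x \<partial>F)"
proof -
  obtain M X Y where "prob_space (M :: ((real ^ 'a) \<times> (real ^ 'a)) measure)"
    and X: "X \<in> borel_measurable M" and Y: "Y \<in> borel_measurable M"
    and dX: "distr M borel X = F" and dY: "distr M borel Y = G"
    and mart: "\<And>\<theta>. AE \<omega> in M. real_cond_exp M (vimage_algebra (space M) Y borel) (\<lambda>\<omega>'. X \<omega>' $ \<theta>) \<omega> = Y \<omega> $ \<theta>"
    using assms(1) unfolding mean_preserving_spread_def by blast
  interpret M: prob_space M by fact
  note [measurable] = X Y
  let ?A = "vimage_algebra (space M) Y borel"
  have sub: "subalgebra M ?A"
    unfolding subalgebra_def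
    by (auto simp: sets_vimage_algebra2 intro!: measurable_sets[OF Y])
  interpret A: finite_measure_subalgebra M ?A
    by unfold_locales (rule sub)
  have pF: "prob_space F" "sets F = sets borel" and pG: "prob_space G" "sets G = sets borel"
    using M.prob_space_distr[OF X] M.prob_space_distr[OF Y] dX dY by auto
  define V where "V = support_function W"
  have Vc: "continuous_on UNIV V" unfolding V_def by (rule continuous_on_support_function[OF W])
  have [measurable]: "V \<in> borel_measurable borel"
    by (rule borel_measurable_continuous_onI[OF Vc])
  have iX: "integrable M (\<lambda>\<omega>. u (X \<omega>))" if "continuous_on UNIV u" for u :: "real ^ 'a \<Rightarrow> real"
    using integrable_continuous_compact_support[OF pF that compact_unit_box F] that
    unfolding dX[symmetric] by (simp add: integrable_distr_eq borel_measurable_continuous_onI)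
  have iY: "integrable M (\<lambda>\<omega>. u (Y \<omega>))" if "continuous_on UNIV u" for u :: "real ^ 'a \<Rightarrow> real"
    using integrable_continuous_compact_support[OF pG that compact_unit_box G] that
    unfolding dY[symmetric] by (simp add: integrable_distr_eq borel_measurable_continuous_onI)
  define Z where "Z = real_cond_exp M ?A (\<lambda>\<omega>. V (X \<omega>))"
  have wY: "AE \<omega> in M. w \<bullet> Y \<omega> \<le> Z \<omega>" if w: "w \<in> W" for w
  proof -
    have comp: "integrable M (\<lambda>\<omega>. X \<omega> $ i)" for i
      by (rule iX[of "\<lambda>x. x $ i"]) (intro continuous_intros)
    have "AE \<omega> in M. real_cond_exp M ?A (\<lambda>\<omega>. w $ i * X \<omega> $ i) \<omega> = w $ i * Y \<omega> $ i" for i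
      using A.real_cond_exp_cmult[OF comp, of "w $ i" i] mart[of i] by eventually_elim simp
    then have "AE \<omega> in M. \<forall>i. real_cond_exp M ?A (\<lambda>\<omega>. w $ i * X \<omega> $ i) \<omega> = w $ i * Y \<omega> $ i"
      by (simp add: AE_all_countable)
    moreover have "AE \<omega> in M. real_cond_exp M ?A (\<lambda>\<omega>. \<Sum>i\<in>UNIV. w $ i * X \<omega> $ i) \<omega>
        = (\<Sum>i\<in>UNIV. real_cond_exp M ?A (\<lambda>\<omega>. w $ i * X \<omega> $ i) \<omega>)"
      using comp by (intro A.real_cond_exp_sum) auto
    moreover have "AE \<omega> in M. real_cond_exp M ?A (\<lambda>\<omega>. \<Sum>i\<in>UNIV. w $ i * X \<omega> $ i) \<omega> \<le> Z \<omega>"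
      unfolding Z_def
    proof (rule A.real_cond_exp_mono)
      have "w \<bullet> x \<le> V x" for x
        unfolding V_def by (rule cSUP_upper[OF w bdd_above_support_function[OF W(1)]])
      then show "AE \<omega> in M. (\<Sum>i\<in>UNIV. w $ i * X \<omega> $ i) \<le> V (X \<omega>)"
        by (simp add: inner_vec_def)
    qed (use comp iX[OF Vc] in auto)
    ultimately show ?thesis by eventually_elim (simp add: inner_vec_def)
  qed
  \<comment> \<open>The exceptional null set depends on \<open>w\<close>. A countable dense subset
    makes it common, and closedness of the half-space extends the inequality to all of
    \<open>W\<close>.\<close>
  obtain D where D: "countable D" "D \<subseteq> W" "W \<subseteq> closure D" by (rule separable)
  have "AE \<omega> in M. \<forall>w\<in>D. w \<bullet> Y \<omega> \<le> Z \<omega>"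
    using D wY by (simp add: AE_ball_countable subset_eq)
  then have VZ: "AE \<omega> in M. V (Y \<omega>) \<le> Z \<omega>"
  proof eventually_elim
    case (elim \<omega>)
    have "closed {w. w \<bullet> Y \<omega> \<le> Z \<omega>}" by (intro closed_Collect_le continuous_intros)
    then have "closure D \<subseteq> {w. w \<bullet> Y \<omega> \<le> Z \<omega>}" using elim by (intro closure_minimal) auto
    then show ?case unfolding V_def using D(3) by (intro cSUP_least[OF W(2)]) auto
  qed
  have "(\<integral>x. V x \<partial>G) = (\<integral>\<omega>. V (Y \<omega>) \<partial>M)" unfolding dY[symmetric] by (simp add: integral_distr)
  also have "\<dots> \<le> (\<integral>\<omega>. Z \<omega> \<partial>M)"
    using VZ iY[OF Vc] A.real_cond_exp_int(1)[OF iX[OF Vc]] by (intro integral_mono_AE) (auto simp: Z_def)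
  also have "\<dots> = (\<integral>\<omega>. V (X \<omega>) \<partial>M)"
    unfolding Z_def by (rule A.real_cond_exp_int(2)[OF iX[OF Vc]])
  also have "\<dots> = (\<integral>x. V x \<partial>F)" unfolding dX[symmetric] by (simp add: integral_distr)
  finally show ?thesis unfolding V_def .
qed

subsection \<open>Mixtures and posterior laws\<close>

lemma integral_count_space_infsum:
  fixes f :: "'i \<Rightarrow> real"
  assumes "integrable (count_space I) f"
  shows "(\<integral>i. f i \<partial>count_space I) = infsum f I"
  using infsetsum_infsum[of f I] assms by (simp add: abs_summable_on_def infsetsum_def)

lemma summable_on_imp_integrable_count_space:
  fixes f :: "'i \<Rightarrow> real"
  assumes "f summable_on I"
  shows "integrable (count_space I) f"
  using abs_summable_equivalent[of f I] summable_on_iff_abs_summable_on_real[of f I] assms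
  unfolding abs_summable_on_def by blast

context
  fixes I :: "'i set" and w :: "'i \<Rightarrow> real" and K :: "'i \<Rightarrow> 'x measure" and N :: "'x measure"
  assumes I: "I \<noteq> {}" and w: "\<And>i. i \<in> I \<Longrightarrow> 0 \<le> w i" "w summable_on I" "infsum w I = 1"
    and K: "\<And>i. i \<in> I \<Longrightarrow> prob_space (K i)" "\<And>i. i \<in> I \<Longrightarrow> sets (K i) = sets N"
begin

lemma prob_space_weights: "prob_space (point_measure I (\<lambda>i. ennreal (w i)))"
proof (rule prob_spaceI)
  have "emeasure (point_measure I (\<lambda>i. ennreal (w i))) I = (\<integral>\<^sup>+i. ennreal (w i) \<partial>count_space I)"
    unfolding point_measure_def by (subst emeasure_density) (auto intro!: nn_integral_cong)
  also have "\<dots> = ennreal (\<integral>i. w i \<partial>count_space I)"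
    using w by (intro nn_integral_eq_integral summable_on_imp_integrable_count_space) (auto simp: AE_count_space)
  also have "(\<integral>i. w i \<partial>count_space I) = 1"
    using w by (simp add: integral_count_space_infsum summable_on_imp_integrable_count_space)
  finally show "emeasure (point_measure I (\<lambda>i. ennreal (w i))) (space (point_measure I (\<lambda>i. ennreal (w i)))) = 1"
    by (simp add: space_point_measure)
qed

lemma kernel_measurable: "K \<in> point_measure I (\<lambda>i. ennreal (w i)) \<rightarrow>\<^sub>M subprob_algebra N"
proof -
  have "K \<in> count_space I \<rightarrow>\<^sub>M subprob_algebra N"
    using K by (auto simp: space_subprob_algebra prob_space_imp_subprob_space)
  then show ?thesis
    by (simp add: measurable_cong_sets[of "point_measure I (\<lambda>i. ennreal (w i))" "count_space I", OF _ refl] sets_point_measure)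
qed

lemma sets_mixture: "sets (mixture I w K) = sets N"
  unfolding mixture_def using I K by (intro sets_bind) (auto simp: space_point_measure)

lemma prob_space_mixture: "prob_space (mixture I w K)"
  unfolding mixture_def
  by (rule prob_space.prob_space_bind[OF prob_space_weights _ kernel_measurable])
    (use K in \<open>auto simp: space_point_measure intro!: AE_I2\<close>)

lemma AE_mixture:
  assumes "Measurable.pred N P" "\<And>i. i \<in> I \<Longrightarrow> AE x in K i. P x"
  shows "AE x in mixture I w K. P x"
  unfolding mixture_def AE_bind[OF kernel_measurable assms(1)]
  by (rule AE_I2) (use assms(2) in \<open>simp add: space_point_measure\<close>)

text \<open>The bind formula is applied to nonnegative integrands, so \<open>f\<close> is first
  shifted to \<open>g = f + B\<close>. Because the weights sum to \<open>1\<close>, the shift adds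
  the same \<open>B\<close> on both sides and cancels.\<close>

lemma integral_mixture:
  assumes f[measurable]: "f \<in> borel_measurable N"
    and f0: "\<And>i. i \<in> I \<Longrightarrow> AE x in K i. \<bar>f x\<bar> \<le> (B :: real)"
  shows "(\<integral>x. f x \<partial>mixture I w K) = (\<Sum>\<^sub>\<infinity>i\<in>I. w i * (\<integral>x. f x \<partial>K i))"
proof -
  let ?P = "point_measure I (\<lambda>i. ennreal (w i))"
  note [measurable_cong] = sets_mixture
  interpret P: prob_space ?P by (rule prob_space_weights)
  interpret M: prob_space "mixture I w K" by (rule prob_space_mixture)
  have AEM: "AE x in mixture I w K. \<bar>f x\<bar> \<le> B" using f0 by (intro AE_mixture) auto
  define g where "g x = f x + B" for x
  have [measurable]: "g \<in> borel_measurable N" unfolding g_def by measurable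
  define h where "h i = (\<integral>x. g x \<partial>K i)" for i
  have fK: "f \<in> borel_measurable (K i)" if "i \<in> I" for i
    using f by (simp add: measurable_cong_sets[OF K(2)[OF that] refl])
  have iK: "integrable (K i) f" if "i \<in> I" for i
    using K(1)[OF that] f0[OF that] fK[OF that]
    by (intro finite_measure.integrable_const_bound[of _ _ B]) (auto simp: prob_space_def)
  have gK: "(\<integral>\<^sup>+x. ennreal (g x) \<partial>K i) = ennreal (h i)" and h: "0 \<le> h i" "h i \<le> 2 * B"
    and hf: "h i = (\<integral>x. f x \<partial>K i) + B" if "i \<in> I" for i
  proof -
    interpret K: prob_space "K i" by (rule K(1)[OF that])
    have i: "integrable (K i) g" unfolding g_def using iK[OF that] by auto
    have ae: "AE x in K i. 0 \<le> g x \<and> g x \<le> 2 * B" using f0[OF that] by eventually_elim (auto simp: g_def)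
    show "(\<integral>\<^sup>+x. ennreal (g x) \<partial>K i) = ennreal (h i)"
      unfolding h_def using ae by (intro nn_integral_eq_integral[OF i]) auto
    show "0 \<le> h i" unfolding h_def using ae by (intro integral_nonneg_AE) auto
    have "h i \<le> (\<integral>x. 2 * B \<partial>K i)" unfolding h_def using ae i by (intro integral_mono_AE) auto
    then show "h i \<le> 2 * B" by (simp add: K.prob_space)
    show "h i = (\<integral>x. f x \<partial>K i) + B"
      unfolding h_def g_def using iK[OF that] by (simp add: K.prob_space)
  qed
  have iM: "integrable (mixture I w K) f"
    using AEM by (intro M.integrable_const_bound[of _ B]) auto
  have ihP: "integrable (count_space I) (\<lambda>i. w i * h i)"
  proof (rule Bochner_Integration.integrable_bound)
    show "integrable (count_space I) (\<lambda>i. w i * (2 * B))"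
      using summable_on_imp_integrable_count_space[OF w(2)] by simp
    show "AE i in count_space I. norm (w i * h i) \<le> norm (w i * (2 * B))"
      using h w(1) by (auto simp: AE_count_space abs_mult intro!: mult_left_mono) (smt (verit))
  qed auto
  have nn: "(\<integral>\<^sup>+x. ennreal (g x) \<partial>mixture I w K) = (\<integral>\<^sup>+i. ennreal (h i) \<partial>?P)"
    unfolding mixture_def
    by (subst nn_integral_bind[OF _ kernel_measurable])
      (auto simp: gK space_point_measure intro!: nn_integral_cong)
  also have "\<dots> = (\<integral>\<^sup>+i. ennreal (w i * h i) \<partial>count_space I)"
    unfolding point_measure_def using w(1) h
    by (subst nn_integral_density) (auto intro!: nn_integral_cong simp: ennreal_mult)
  also have "\<dots> = ennreal (\<integral>i. w i * h i \<partial>count_space I)"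
    using w(1) h by (intro nn_integral_eq_integral[OF ihP]) (auto simp: AE_count_space)
  finally have *: "(\<integral>\<^sup>+x. ennreal (g x) \<partial>mixture I w K) = ennreal (\<integral>i. w i * h i \<partial>count_space I)" .
  have "(\<integral>x. g x \<partial>mixture I w K) = (\<integral>i. w i * h i \<partial>count_space I)"
  proof (subst integral_eq_nn_integral)
    show "AE x in mixture I w K. 0 \<le> g x" using AEM by eventually_elim (auto simp: g_def)
    have "0 \<le> (\<integral>i. w i * h i \<partial>count_space I)" using w(1) h by (intro integral_nonneg_AE) (auto simp: AE_count_space)
    then show "enn2real (\<integral>\<^sup>+x. ennreal (g x) \<partial>mixture I w K) = (\<integral>i. w i * h i \<partial>count_space I)"
      unfolding * by simp
  qed auto
  moreover have "(\<integral>x. g x \<partial>mixture I w K) = (\<integral>x. f x \<partial>mixture I w K) + B"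
    unfolding g_def using iM by (simp add: M.prob_space)
  moreover have "(\<integral>i. w i * h i \<partial>count_space I) = (\<integral>i. w i * (\<integral>x. f x \<partial>K i) \<partial>count_space I) + B"
  proof -
    have iw: "integrable (count_space I) (\<lambda>i. w i * B)"
      using summable_on_imp_integrable_count_space[OF w(2)] by simp
    have "(\<integral>i. w i * (\<integral>x. f x \<partial>K i) \<partial>count_space I) = (\<integral>i. w i * h i - w i * B \<partial>count_space I)"
      by (intro Bochner_Integration.integral_cong) (auto simp: hf algebra_simps)
    also have "\<dots> = (\<integral>i. w i * h i \<partial>count_space I) - (\<integral>i. w i \<partial>count_space I) * B"
      using ihP iw by simp
    also have "(\<integral>i. w i \<partial>count_space I) = 1"
      using w by (simp add: integral_count_space_infsum summable_on_imp_integrable_count_space)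
    finally show ?thesis by simp
  qed
  moreover have "integrable (count_space I) (\<lambda>i. w i * (\<integral>x. f x \<partial>K i))"
  proof (rule iffD1[OF Bochner_Integration.integrable_cong[OF refl]])
    show "integrable (count_space I) (\<lambda>i. w i * h i - w i * B)"
      using summable_on_imp_integrable_count_space[OF w(2)] ihP by (intro Bochner_Integration.integrable_diff) auto
  qed (auto simp: hf algebra_simps)
  ultimately show ?thesis by (simp add: integral_count_space_infsum)
qed

end

section \<open>Posterior laws as probability measures on the simplex\<close>

lemma closed_belief_simplex: "closed (belief_simplex :: (real ^ 'a::finite) set)"
  unfolding belief_simplex_def
  by (intro closed_Collect_conj closed_Collect_all closed_Collect_le closed_Collect_eq continuous_intros)

lemma measurable_borel_of_topology:
  assumes "continuous_map X Y f"
  shows "f \<in> borel_of_topology X \<rightarrow>\<^sub>M borel_of_topology Y"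
proof -
  have sp: "{U. openin Z U} \<subseteq> Pow (topspace Z)" for Z :: "'z topology" using openin_subset by auto
  have "space (borel_of_topology X) = topspace X"
    unfolding borel_of_topology_def by (simp add: space_measure_of sp)
  moreover have "{x \<in> topspace X. f x \<in> U} \<in> sets (borel_of_topology X)" if "openin Y U" for U
    using openin_continuous_map_preimage[OF assms that]
    unfolding borel_of_topology_def by (simp add: sets_measure_of sp)
  ultimately show ?thesis
    unfolding borel_of_topology_def[of Y]
    using continuous_map_image_subset_topspace[OF assms] sp[of Y]
    by (intro measurable_measure_of) (auto simp: vimage_def Int_def conj_commute)
qed

context
  fixes T :: enat and S :: "nat \<Rightarrow> 's topology" and \<pi> :: "'a::finite \<Rightarrow> (nat \<Rightarrow> 's) measure"
    and \<mu> :: "real ^ 'a"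
  assumes info: "info_structure T S \<pi>" and \<mu>: "\<mu> \<in> belief_simplex"
begin

lemma joint_law_kernel:
  "prob_space (distr (\<pi> \<theta>) (count_space UNIV \<Otimes>\<^sub>M borel_of_topology (product_topology S (periods T))) (Pair \<theta>))"
proof -
  let ?B = "borel_of_topology (product_topology S (periods T))"
  have s: "sets (\<pi> \<theta>) = sets ?B" and p: "prob_space (\<pi> \<theta>)"
    using info by (simp_all add: info_structure_def)
  have "Pair \<theta> \<in> ?B \<rightarrow>\<^sub>M count_space UNIV \<Otimes>\<^sub>M ?B" by (rule measurable_Pair1') simp
  then have "Pair \<theta> \<in> \<pi> \<theta> \<rightarrow>\<^sub>M count_space UNIV \<Otimes>\<^sub>M ?B"
    by (simp only: measurable_cong_sets[OF s refl])
  then show ?thesis by (rule prob_space.prob_space_distr[OF p])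
qed

lemma prior_weights: "0 \<le> \<mu> $ \<theta>" "(\<lambda>\<theta>. \<mu> $ \<theta>) summable_on UNIV" "infsum (\<lambda>\<theta>. \<mu> $ \<theta>) UNIV = 1"
  using \<mu> by (auto simp: belief_simplex_def)

lemma sets_joint_law:
  "sets (joint_law T \<mu> S \<pi>) = sets (count_space UNIV \<Otimes>\<^sub>M borel_of_topology (product_topology S (periods T)))"
  unfolding joint_law_def using prior_weights joint_law_kernel by (intro sets_mixture) auto

lemma prob_space_joint_law: "prob_space (joint_law T \<mu> S \<pi>)"
  unfolding joint_law_def using prior_weights joint_law_kernel by (intro prob_space_mixture) auto

text \<open>The signal paths carry the Borel algebra of the product topology, so measurability of
  truncation to the first \<open>t\<close> signals is derived from its continuity. Truncation makes
  sense because all periods up to \<open>t\<close> lie within the horizon.\<close>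

lemma subalgebra_history:
  assumes "t \<in> periods T"
  shows "subalgebra (joint_law T \<mu> S \<pi>) (history_algebra T \<mu> S \<pi> t)"
proof -
  have "{1..t} \<subseteq> periods T"
  proof
    fix k assume "k \<in> {1..t}"
    then have "1 \<le> k" "enat k \<le> enat t" by auto
    moreover have "enat t \<le> T" using assms by (simp add: periods_def)
    ultimately show "k \<in> periods T" by (simp only: periods_def mem_Collect_eq) (metis order_trans)
  qed
  then have "continuous_map (product_topology S (periods T)) (product_topology S {1..t}) (\<lambda>s. restrict s {1..t})"
    unfolding continuous_map_componentwise
    by (auto simp: continuous_map_product_projection subset_eq)
  from measurable_borel_of_topology[OF this]
  have "(\<lambda>\<omega>. restrict (snd \<omega>) {1..t}) \<in> joint_law T \<mu> S \<pi> \<rightarrow>\<^sub>M borel_of_topology (product_topology S {1..t})"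
    unfolding measurable_cong_sets[OF sets_joint_law refl]
    by (rule measurable_compose[OF measurable_snd])
  from measurable_sets[OF this] measurable_space[OF this] show ?thesis
    unfolding subalgebra_def history_algebra_def
    by (auto simp: sets_vimage_algebra2)
qed

text \<open>The events that fix the state partition the sample space into finitely many pieces. The
  conditional expectations of their indicators are therefore almost surely nonnegative and sum to
  the conditional expectation of \<open>1\<close>.\<close>

lemma prob_space_posterior_law:
  assumes "t \<in> periods T"
  shows "prob_space (posterior_law T \<mu> S \<pi> t)"
    and "sets (posterior_law T \<mu> S \<pi> t) = sets borel"
    and "AE x in posterior_law T \<mu> S \<pi> t. x \<in> belief_simplex"
proof -
  let ?J = "joint_law T \<mu> S \<pi>" and ?H = "history_algebra T \<mu> S \<pi> t"
  interpret J: prob_space ?J by (rule prob_space_joint_law)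
  interpret H: finite_measure_subalgebra ?J ?H
    by unfold_locales (rule subalgebra_history[OF assms])
  have m: "posterior T \<mu> S \<pi> t \<in> borel_measurable ?J"
    unfolding borel_measurable_euclidean_space[of "posterior T \<mu> S \<pi> t"]
    by (auto simp: Basis_vec_def inner_axis posterior_def borel_measurable_cond_exp2)
  show "prob_space (posterior_law T \<mu> S \<pi> t)"
    unfolding posterior_law_def by (rule J.prob_space_distr[OF m])
  show "sets (posterior_law T \<mu> S \<pi> t) = sets borel" by (simp add: posterior_law_def)
  let ?p = "\<lambda>\<theta>. real_cond_exp ?J ?H (indicator {\<omega>'. fst \<omega>' = \<theta>})"
  have "fst \<in> ?J \<rightarrow>\<^sub>M count_space UNIV"
    unfolding measurable_cong_sets[OF sets_joint_law refl] by simp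
  then have [measurable]: "Measurable.pred ?J (\<lambda>\<omega>. fst \<omega> = \<theta>)" for \<theta> by measurable
  have ind: "(indicator {\<omega>'. fst \<omega>' = \<theta>} :: _ \<Rightarrow> real) = (\<lambda>\<omega>. if fst \<omega> = \<theta> then 1 else 0)" for \<theta>
    by (auto simp: fun_eq_iff)
  have int: "integrable ?J (indicator {\<omega>'. fst \<omega>' = \<theta>} :: _ \<Rightarrow> real)" for \<theta>
    unfolding ind by (intro J.integrable_const_bound[of _ 1]) auto
  have "AE \<omega> in ?J. \<forall>\<theta>. 0 \<le> ?p \<theta> \<omega>"
    unfolding AE_all_countable
    by (intro allI H.real_cond_exp_pos borel_measurable_integrable int) auto
  moreover have "AE \<omega> in ?J. real_cond_exp ?J ?H (\<lambda>\<omega>. \<Sum>\<theta>\<in>UNIV. indicator {\<omega>'. fst \<omega>' = \<theta>} \<omega>) \<omega> = (\<Sum>\<theta>\<in>UNIV. ?p \<theta> \<omega>)"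
    by (rule H.real_cond_exp_sum[OF int])
  moreover have "AE \<omega> in ?J. real_cond_exp ?J ?H (\<lambda>\<omega>. \<Sum>\<theta>\<in>UNIV. indicator {\<omega>'. fst \<omega>' = \<theta>} \<omega>) \<omega> = 1"
  proof -
    have "(\<lambda>\<omega>. \<Sum>\<theta>\<in>UNIV. indicator {\<omega>'. fst \<omega>' = \<theta>} \<omega> :: real) = (\<lambda>\<omega> :: 'a \<times> (nat \<Rightarrow> 's). 1)"
      by (auto simp: ind fun_eq_iff)
    then show ?thesis using H.real_cond_exp_F_meas[of "\<lambda>_. 1"] by simp
  qed
  ultimately have "AE \<omega> in ?J. posterior T \<mu> S \<pi> t \<omega> \<in> belief_simplex"
    by eventually_elim (simp add: belief_simplex_def posterior_def)
  then show "AE x in posterior_law T \<mu> S \<pi> t. x \<in> belief_simplex"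
    unfolding posterior_law_def by (subst AE_distr_iff[OF m]) (auto simp: borel_closed closed_belief_simplex)
qed

end

subsection \<open>Discounted problems\<close>

lemma belief_simplex_subset_unit_box: "belief_simplex \<subseteq> unit_box"
proof
  fix x :: "real ^ 'a" assume x: "x \<in> belief_simplex"
  have "x $ i \<le> (\<Sum>\<theta>\<in>UNIV. x $ \<theta>)" for i
    using x by (intro member_le_sum) (auto simp: belief_simplex_def)
  then show "x \<in> unit_box" using x by (auto simp: belief_simplex_def unit_box_def)
qed

definition payoff_vectors :: "'b topology \<Rightarrow> ('b \<Rightarrow> 'a::finite \<Rightarrow> real) \<Rightarrow> (real ^ 'a) set" where
  "payoff_vectors A v = (\<lambda>a. \<chi> \<theta>. v a \<theta>) ` topspace A"

lemma belief_value_eq_support_function: "belief_value A v = support_function (payoff_vectors A v)"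
  by (simp add: fun_eq_iff belief_value_def payoff_vectors_def image_image inner_vec_def mult.commute)

text \<open>For each state the payoff is a continuous function on a compact space, hence bounded;
  summing over the finitely many states bounds the norm.\<close>

lemma bounded_payoff_vectors:
  assumes "discounted_problem T \<beta> A v"
  shows "bounded (payoff_vectors A v)" "payoff_vectors A v \<noteq> {}"
proof -
  have A: "compact_space A" "topspace A \<noteq> {}"
    and v: "continuous_map (prod_topology A (discrete_topology UNIV)) euclideanreal (\<lambda>(a, \<theta>). v a \<theta>)"
    using assms by (auto simp: discounted_problem_def)
  show "payoff_vectors A v \<noteq> {}" using A by (simp add: payoff_vectors_def)
  have "\<exists>B. \<forall>a\<in>topspace A. \<bar>v a \<theta>\<bar> \<le> B" for \<theta>
  proof -
    have "continuous_map A (prod_topology A (discrete_topology UNIV)) (\<lambda>a. (a, \<theta>))"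
      by (simp add: continuous_map_paired)
    from continuous_map_compose[OF this v]
    have "continuous_map A euclideanreal (\<lambda>a. v a \<theta>)" by (simp add: comp_def)
    from image_compactin[OF A(1)[unfolded compact_space_def] this]
    have "bounded ((\<lambda>a. v a \<theta>) ` topspace A)" by (simp add: compact_imp_bounded)
    then show ?thesis by (auto simp: bounded_iff)
  qed
  then obtain B where B: "\<And>\<theta> a. a \<in> topspace A \<Longrightarrow> \<bar>v a \<theta>\<bar> \<le> B \<theta>" by metis
  have "norm w \<le> (\<Sum>\<theta>\<in>UNIV. B \<theta>)" if w: "w \<in> payoff_vectors A v" for w
  proof -
    have "norm w \<le> (\<Sum>\<theta>\<in>UNIV. \<bar>w $ \<theta>\<bar>)" by (rule norm_le_l1_cart)
    also have "\<dots> \<le> (\<Sum>\<theta>\<in>UNIV. B \<theta>)" using w B by (intro sum_mono) (auto simp: payoff_vectors_def)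
    finally show ?thesis .
  qed
  then show "bounded (payoff_vectors A v)" by (auto simp: bounded_iff)
qed

lemma discount_weights:
  assumes "discount_sequence T \<beta>"
  defines "w \<equiv> \<lambda>t. \<beta> t / infsum \<beta> (periods T)"
  shows "\<And>t. t \<in> periods T \<Longrightarrow> 0 \<le> w t" "w summable_on periods T" "infsum w (periods T) = 1"
proof -
  have \<beta>: "\<And>t. t \<in> periods T \<Longrightarrow> 0 \<le> \<beta> t" "\<beta> summable_on periods T" "0 < infsum \<beta> (periods T)"
    using assms(1) by (auto simp: discount_sequence_def)
  show "0 \<le> w t" if "t \<in> periods T" for t using \<beta> that by (simp add: w_def)
  have w: "w = (\<lambda>t. inverse (infsum \<beta> (periods T)) * \<beta> t)" by (simp add: w_def divide_inverse mult.commute)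
  show "w summable_on periods T" unfolding w by (intro summable_on_cmult_right \<beta>)
  show "infsum w (periods T) = 1" unfolding w using \<beta>(3) by (subst infsum_cmult_right') simp
qed

lemma periods_nonempty: "1 \<le> T \<Longrightarrow> periods T \<noteq> {}"
  by (auto simp: periods_def one_enat_def intro!: exI[of _ 1])

context
  fixes T :: enat and S :: "nat \<Rightarrow> 's topology" and \<pi> :: "'a::finite \<Rightarrow> (nat \<Rightarrow> 's) measure"
    and \<mu> :: "real ^ 'a" and \<beta> :: "nat \<Rightarrow> real"
  assumes T: "1 \<le> T" and info: "info_structure T S \<pi>" and \<mu>: "\<mu> \<in> belief_simplex"
    and \<beta>: "discount_sequence T \<beta>"
begin

lemma prob_space_discounted_mixture: "prob_space (discounted_mixture T \<beta> (posterior_law T \<mu> S \<pi>))"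
  unfolding discounted_mixture_def
  by (rule prob_space_mixture[OF periods_nonempty[OF T] discount_weights[OF \<beta>] prob_space_posterior_law(1,2)[OF info \<mu>]])

lemma sets_discounted_mixture: "sets (discounted_mixture T \<beta> (posterior_law T \<mu> S \<pi>)) = sets borel"
  unfolding discounted_mixture_def
  by (rule sets_mixture[OF periods_nonempty[OF T] discount_weights[OF \<beta>] prob_space_posterior_law(1,2)[OF info \<mu>]])

lemma AE_discounted_mixture: "AE x in discounted_mixture T \<beta> (posterior_law T \<mu> S \<pi>). x \<in> belief_simplex"
  unfolding discounted_mixture_def
proof (rule AE_mixture[OF periods_nonempty[OF T] discount_weights[OF \<beta>] prob_space_posterior_law(1,2)[OF info \<mu>]])
  show "Measurable.pred borel (\<lambda>x :: real ^ 'a. x \<in> belief_simplex)"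
    using borel_closed[OF closed_belief_simplex] by (simp add: pred_def)
qed (use prob_space_posterior_law(3)[OF info \<mu>] in auto)

lemma AE_discounted_mixture_unit_box: "AE x in discounted_mixture T \<beta> (posterior_law T \<mu> S \<pi>). x \<in> unit_box"
  using AE_discounted_mixture belief_simplex_subset_unit_box by (auto elim: eventually_mono)

text \<open>Posteriors stay almost surely in a compact set, where the value function is bounded, so
  the integral over the mixture splits into periods. The total discount weight then undoes the
  normalisation.\<close>

lemma optimal_utility_eq_integral_discounted_mixture:
  assumes "continuous_on UNIV (belief_value A v)"
  shows "optimal_utility T \<beta> A v \<mu> S \<pi> =
    infsum \<beta> (periods T) * (\<integral>x. belief_value A v x \<partial>discounted_mixture T \<beta> (posterior_law T \<mu> S \<pi>))"
proof -
  let ?V = "belief_value A v" and ?F = "posterior_law T \<mu> S \<pi>"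
  have "bounded (?V ` unit_box)"
    using assms by (intro compact_imp_bounded compact_continuous_image compact_unit_box)
      (auto intro: continuous_on_subset)
  then obtain B where B: "\<And>x. x \<in> unit_box \<Longrightarrow> \<bar>?V x\<bar> \<le> B" by (auto simp: bounded_iff)
  have "(\<integral>x. ?V x \<partial>discounted_mixture T \<beta> ?F)
      = (\<Sum>\<^sub>\<infinity>t\<in>periods T. \<beta> t / infsum \<beta> (periods T) * (\<integral>x. ?V x \<partial>?F t))"
    unfolding discounted_mixture_def
  proof (rule integral_mixture[OF periods_nonempty[OF T] discount_weights[OF \<beta>] prob_space_posterior_law(1,2)[OF info \<mu>]])
    show "?V \<in> borel_measurable borel" by (rule borel_measurable_continuous_onI[OF assms])
    show "AE x in ?F t. \<bar>?V x\<bar> \<le> B" if "t \<in> periods T" for t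
      using prob_space_posterior_law(3)[OF info \<mu> that] B belief_simplex_subset_unit_box
      by (auto elim!: eventually_mono)
  qed
  then have "infsum \<beta> (periods T) * (\<integral>x. ?V x \<partial>discounted_mixture T \<beta> ?F)
      = (\<Sum>\<^sub>\<infinity>t\<in>periods T. infsum \<beta> (periods T) * (\<beta> t / infsum \<beta> (periods T) * (\<integral>x. ?V x \<partial>?F t)))"
    by (simp only: infsum_cmult_right')
  also have "\<dots> = optimal_utility T \<beta> A v \<mu> S \<pi>"
    using \<beta> unfolding optimal_utility_def discount_sequence_def by (intro infsum_cong) auto
  finally show ?thesis ..
qed

end

text \<open>Each affine function becomes one action. An infinite action type has room for any finite
  number of them, and with the discrete topology on a finite carrier compactness and continuity are
  immediate.\<close>

lemma affine_max_as_belief_value: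
  fixes N :: "(real \<times> (real ^ 'a::finite)) set"
  assumes "infinite (UNIV :: 'b set)" "finite N" "N \<noteq> {}" "discount_sequence T \<beta>"
  obtains A :: "'b topology" and v where "discounted_problem T \<beta> A v"
    and "\<And>x. x \<in> belief_simplex \<Longrightarrow> belief_value A v x = affine_max N x"
proof -
  obtain C :: "'b set" where C: "finite C" "card C = card N"
    using infinite_arbitrarily_large[OF assms(1)] by metis
  then obtain h where h: "bij_betw h C N" using finite_same_card_bij assms(2) by metis
  define A where "A = discrete_topology C"
  \<comment> \<open>The constant term is paid in every state; its expectation is unchanged because
    beliefs sum to \<open>1\<close>.\<close>
  define v where "v a \<theta> = fst (h a) + snd (h a) $ \<theta>" for a \<theta>
  have "discounted_problem T \<beta> A v"
    unfolding discounted_problem_def A_def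
    using C h assms
    by (auto simp: compact_space_discrete_topology bij_betw_def prod_topology_discrete_topology[symmetric])
  moreover have "belief_value A v x = affine_max N x" if "x \<in> belief_simplex" for x
  proof -
    have "(\<Sum>\<theta>\<in>UNIV. x $ \<theta> * v a \<theta>) = fst (h a) + snd (h a) \<bullet> x" for a
    proof -
      have "(\<Sum>\<theta>\<in>UNIV. x $ \<theta> * v a \<theta>) = fst (h a) * (\<Sum>\<theta>\<in>UNIV. x $ \<theta>) + snd (h a) \<bullet> x"
        by (simp add: v_def inner_vec_def sum_distrib_left sum.distrib algebra_simps)
      then show ?thesis using that by (simp add: belief_simplex_def)
    qed
    then have "belief_value A v x = (SUP a\<in>C. (\<lambda>(\<alpha>, w). \<alpha> + w \<bullet> x) (h a))"
      by (simp add: belief_value_def A_def case_prod_beta')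
    also have "\<dots> = Sup ((\<lambda>(\<alpha>, w). \<alpha> + w \<bullet> x) ` N)"
      using h by (simp add: bij_betw_def image_image[symmetric])
    also have "\<dots> = affine_max N x"
      using assms by (intro cSup_eq_Max) auto
    finally show ?thesis .
  qed
  ultimately show ?thesis by (rule that)
qed

theorem corollary3p3:
  fixes T :: enat
    and \<mu> :: "real ^ 'a::finite"
    and S\<^sub>1 :: "nat \<Rightarrow> 's topology" and \<pi>\<^sub>1 :: "'a \<Rightarrow> (nat \<Rightarrow> 's) measure"
    and S\<^sub>2 :: "nat \<Rightarrow> 'r topology" and \<pi>\<^sub>2 :: "'a \<Rightarrow> (nat \<Rightarrow> 'r) measure"
  assumes "1 \<le> T"
    and "\<mu> \<in> rel_interior belief_simplex"
    and "info_structure T S\<^sub>1 \<pi>\<^sub>1"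
    and "info_structure T S\<^sub>2 \<pi>\<^sub>2"
    and "infinite (UNIV :: 'b set)"
  shows "dominates_discounted TYPE('b) T \<mu> S\<^sub>1 \<pi>\<^sub>1 S\<^sub>2 \<pi>\<^sub>2 \<longleftrightarrow>
    (\<forall>\<beta>. discount_sequence T \<beta> \<longrightarrow>
       discounted_mixture T \<beta> (posterior_law T \<mu> S\<^sub>1 \<pi>\<^sub>1) \<succeq>
       discounted_mixture T \<beta> (posterior_law T \<mu> S\<^sub>2 \<pi>\<^sub>2))"
proof -
  have \<mu>: "\<mu> \<in> belief_simplex" using assms(2) rel_interior_subset by blast
  let ?F = "\<lambda>\<beta>. discounted_mixture T \<beta> (posterior_law T \<mu> S\<^sub>1 \<pi>\<^sub>1)"
  let ?G = "\<lambda>\<beta>. discounted_mixture T \<beta> (posterior_law T \<mu> S\<^sub>2 \<pi>\<^sub>2)"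
  \<comment> \<open>Both utilities carry the same positive factor
    \<open>infsum \<beta> (periods T)\<close>, so comparing them amounts to comparing integrals over
    the two mixtures.\<close>
  have utility_le_iff: "optimal_utility T \<beta> A v \<mu> S\<^sub>2 \<pi>\<^sub>2 \<le> optimal_utility T \<beta> A v \<mu> S\<^sub>1 \<pi>\<^sub>1 \<longleftrightarrow>
      (\<integral>x. belief_value A v x \<partial>?G \<beta>) \<le> (\<integral>x. belief_value A v x \<partial>?F \<beta>)"
    if P: "discounted_problem T \<beta> A v" for \<beta> and A :: "'b topology" and v :: "'b \<Rightarrow> 'a \<Rightarrow> real"
  proof -
    have \<beta>: "discount_sequence T \<beta>" using P by (simp add: discounted_problem_def)
    have V: "continuous_on UNIV (belief_value A v)"
      unfolding belief_value_eq_support_function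
      by (rule continuous_on_support_function[OF bounded_payoff_vectors[OF P]])
    show ?thesis
      using optimal_utility_eq_integral_discounted_mixture[OF assms(1,3) \<mu> \<beta> V]
        optimal_utility_eq_integral_discounted_mixture[OF assms(1,4) \<mu> \<beta> V] \<beta>
      by (simp add: discount_sequence_def)
  qed
  show ?thesis
  proof (intro iffI allI impI)
    fix \<beta> assume dom: "dominates_discounted TYPE('b) T \<mu> S\<^sub>1 \<pi>\<^sub>1 S\<^sub>2 \<pi>\<^sub>2" and \<beta>: "discount_sequence T \<beta>"
    note AEF = AE_discounted_mixture[OF assms(1,3) \<mu> \<beta>]
    note AEG = AE_discounted_mixture[OF assms(1,4) \<mu> \<beta>]
    show "?F \<beta> \<succeq> ?G \<beta>"
    proof (rule affine_domination_imp_mean_preserving_spread)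
      fix N :: "(real \<times> (real ^ 'a)) set" assume N: "finite N" "N \<noteq> {}"
      \<comment> \<open>The test problem keeps the given \<beta>, so dominance speaks about exactly
        this pair of mixtures.\<close>
      obtain A :: "'b topology" and v where P: "discounted_problem T \<beta> A v"
        and eq: "\<And>x. x \<in> belief_simplex \<Longrightarrow> belief_value A v x = affine_max N x"
        using affine_max_as_belief_value[OF assms(5) N \<beta>] by blast
      have [measurable]: "belief_value A v \<in> borel_measurable borel" "affine_max N \<in> borel_measurable borel"
        unfolding belief_value_eq_support_function
        by (intro borel_measurable_continuous_onI continuous_on_support_function bounded_payoff_vectors[OF P]
            continuous_on_affine_max N)+
      note [measurable_cong] = sets_discounted_mixture[OF assms(1,3) \<mu> \<beta>] sets_discounted_mixture[OF assms(1,4) \<mu> \<beta>]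
      \<comment> \<open>The two integrands are known to agree on the simplex, which has full mass
        under both mixtures.\<close>
      have "(\<integral>x. affine_max N x \<partial>?G \<beta>) = (\<integral>x. belief_value A v x \<partial>?G \<beta>)"
        using AEG eq by (intro integral_cong_AE) (measurable, auto elim!: eventually_mono)
      also have "\<dots> \<le> (\<integral>x. belief_value A v x \<partial>?F \<beta>)"
        using dom P utility_le_iff[OF P] by (auto simp: dominates_discounted_def)
      also have "\<dots> = (\<integral>x. affine_max N x \<partial>?F \<beta>)"
        using AEF eq by (intro integral_cong_AE) (measurable, auto elim!: eventually_mono)
      finally show "(\<integral>x. affine_max N x \<partial>?G \<beta>) \<le> (\<integral>x. affine_max N x \<partial>?F \<beta>)" .
    qed (intro prob_space_discounted_mixture sets_discounted_mixture AE_discounted_mixture_unit_box assms \<mu> \<beta>)+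
  next
    assume spread: "\<forall>\<beta>. discount_sequence T \<beta> \<longrightarrow> ?F \<beta> \<succeq> ?G \<beta>"
    show "dominates_discounted TYPE('b) T \<mu> S\<^sub>1 \<pi>\<^sub>1 S\<^sub>2 \<pi>\<^sub>2"
      unfolding dominates_discounted_def
    proof (intro allI impI)
      fix \<beta> and A :: "'b topology" and v :: "'b \<Rightarrow> 'a \<Rightarrow> real" assume P: "discounted_problem T \<beta> A v"
      then have \<beta>: "discount_sequence T \<beta>" by (simp add: discounted_problem_def)
      show "optimal_utility T \<beta> A v \<mu> S\<^sub>2 \<pi>\<^sub>2 \<le> optimal_utility T \<beta> A v \<mu> S\<^sub>1 \<pi>\<^sub>1"
        unfolding utility_le_iff[OF P] belief_value_eq_support_function
        using spread \<beta>
        by (intro mean_preserving_spread_imp_support_function_le AE_discounted_mixture_unit_box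
            assms \<mu> bounded_payoff_vectors[OF P]) auto
    qed
  qed
qed

end
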